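(* There are absolute constants such that the following holds for large primes $p$. Let $A \subseteq \mathbb{F}_p^*$ with $|A| = \alpha p$, where $\alpha \gg \frac{(\log\log p)^{2/3}}{(\log p)^{1/3}}$. Then $$|A + A^*| > \min\big(2\sqrt{|A|p},\, p\big) - O\bigg(\frac{(\log\log p)^{1/3}}{(\log p)^{1/6}}\bigg)p.$$ Furthermore, if $\epsilon>0$ satisfies $\alpha^3 \gg \epsilon \gg \alpha\frac{(\log\log p)^{4/3}}{(\log p)^{2/3}}$, then $$|A +_{\epsilon} A^*| \geqslant \min\big(2\sqrt{|A|p},\, p\big) - O\bigg(\frac{\epsilon^{1/4}}{\alpha^{1/4}}\bigg)p.$$
   Context: $p$ is a prime, $\mathbb{F}_p^* = \mathbb{F}_p\setminus\{0\}$, and $A^* = \{a^{-1} : a \in A\}$ for $A \subseteq \mathbb{F}_p^*$. For $X, Y \subseteq \mathbb{F}_p$, $X+Y=\{x+y: x\in X, y\in Y\}$, and $(X*Y)(z) = \#\{(x,y)\in X\times Y : x+y=z\}$. For $\epsilon>0$ the partial sumset is $X +_{\epsilon} Y := \{z \in X+Y : (X*Y)(z) \geqslant \epsilon p\}$. Notation $X \ll Y$, $Y\gg X$, $X = O(Y)$ means $X \leqslant cY$ for some absolute constant $c>0$. *)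

theory Defs
  imports Complex_Main "HOL-Number_Theory.Residues"
begin

abbreviation Fp :: "nat \<Rightarrow> int ring"
  where "Fp p \<equiv> residue_ring (int p)"

text \<open>Only used for sets of units: \<open>inv\<^bsub>Fp p\<^esub> 0\<close> is unspecified.\<close>

definition inverse_set :: "nat \<Rightarrow> int set \<Rightarrow> int set"
  where "inverse_set p A = {inv\<^bsub>Fp p\<^esub> a | a. a \<in> A}"

text \<open>The sumset \<open>X + Y\<close> in \<open>Fp p\<close> is the library's \<open>X <+>\<^bsub>Fp p\<^esub> Y\<close>.\<close>

definition conv_count :: "nat \<Rightarrow> int set \<Rightarrow> int set \<Rightarrow> int \<Rightarrow> nat"
  where "conv_count p X Y z = card {(x, y). x \<in> X \<and> y \<in> Y \<and> x \<oplus>\<^bsub>Fp p\<^esub> y = z}"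

definition partial_sumset :: "nat \<Rightarrow> real \<Rightarrow> int set \<Rightarrow> int set \<Rightarrow> int set"
  where "partial_sumset p \<epsilon> X Y =
    {z \<in> X <+>\<^bsub>Fp p\<^esub> Y. real (conv_count p X Y z) \<ge> \<epsilon> * real p}"

end

theory Submission
  imports Defs "HOL-Library.FuncSet"
begin

text \<open>
  Let \<open>f\<close> be the convolution of the indicators of \<open>A\<close> and \<open>A\<^sup>*\<close>. Random sampling in the style of Croot and
  Sisask yields a set \<open>T\<close> of size \<open>p\<^sup>1\<^sup>-\<^sup>o\<^sup>(\<^sup>1\<^sup>)\<close> such that \<open>f\<close> hardly changes when the indicators of \<open>A\<close> and \<open>A\<^sup>*\<close>
  are replaced by their convolutions \<open>f\<^sub>1, f\<^sub>2\<close> with \<open>\<mu>\<^sub>T * \<mu>\<^sub>-\<^sub>T\<close>. The functions \<open>g\<^sub>i = 1 - (1 - f\<^sub>i)\<^sup>m\<close> are close to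
  \<open>1\<close> on almost all of \<open>A\<close> and \<open>A\<^sup>*\<close>, and since \<open>T\<close> is large they have a small Fourier \<open>\<ell>\<^sup>1\<close> norm; no
  Bohr set is needed. Hence the Kloosterman bound gives \<open>|A| p \<le> (\<Sum>g\<^sub>1) (\<Sum>g\<^sub>2)\<close> up to a small error, and
  \<open>\<Sum>g\<^sub>1 + \<Sum>g\<^sub>2 \<ge> 2 sqrt (|A| p)\<close> by AM-GM. Finally Pollard's theorem, applied to all pairs of level sets of
  \<open>f\<^sub>1\<close> and \<open>f\<^sub>2\<close>, bounds \<open>\<Sum>g\<^sub>1 + \<Sum>g\<^sub>2\<close> by the number of popular sums.
\<close>

section \<open>Periodic functions and Pollard's theorem\<close>

text \<open>Let \<delta> be the error relative to p. Three demands fix the sizes. The mass of A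
  missed by g_1 or g_2 is of order p/m and may be at most sqrt(\<alpha>) \<delta> p, so m is about
  1/(sqrt(\<alpha>) \<delta>). The weighted Pollard step sees sums of popularity \<delta>^2 p / m^2,
  about \<alpha> \<delta>^4 p; hence \<epsilon> is about \<alpha> \<delta>^4 and the error is a
  fourth root. Predicting f to accuracy \<epsilon> p from samples of a set of size \<alpha> p takes
  k of order log(1/\<delta>) / \<delta>^4 samples, and T has density about \<alpha>^k. Saturation is
  done by a polynomial because the Fourier l1 norm is submultiplicative: the norm of g_i is
  exponential in m k log(1/\<delta>). Kloosterman sums are bounded by O(p^(3/4)), which leaves
  p^(1/4) for the product of two norms. As \<delta> <= sqrt(\<alpha>)/2, this asks for
  log(1/\<delta>)^2 / \<delta>^6 = O(log p), and the smallest such \<delta> is of order (log log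
  p)^(1/3) / (log p)^(1/6).\<close>

locale prime_modulus =
  fixes p :: nat
  assumes prime_p: "prime p"
begin

abbreviation G :: "int set" where "G \<equiv> {0..<int p}"

text \<open>Subsets of \<open>Fp p\<close> are represented by \<open>p\<close>-periodic sets of integers: translations then need no
  reduction modulo \<open>p\<close>.\<close>

definition periodic :: "(int \<Rightarrow> 'a) \<Rightarrow> bool"
  where "periodic f \<longleftrightarrow> (\<forall>x. f (x mod int p) = f x)"

lemma p_pos [simp]: "0 < p"
  using prime_p prime_gt_0_nat by blast

lemma periodic_mod: "periodic f \<Longrightarrow> f (x mod int p) = f x"
  by (simp add: periodic_def)

lemma periodic_cong: "periodic f \<Longrightarrow> x mod int p = y mod int p \<Longrightarrow> f x = f y"
  by (metis periodic_def)

lemma periodic_shift: "periodic f \<Longrightarrow> periodic (\<lambda>x. f (x + c))"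
  unfolding periodic_def by (metis mod_add_left_eq)

lemma periodic_diff: "periodic f \<Longrightarrow> periodic (\<lambda>x. f (x - c))"
  unfolding periodic_def by (metis mod_diff_left_eq)

lemma periodic_reflect: "periodic f \<Longrightarrow> periodic (\<lambda>x. f (c - x))"
  unfolding periodic_def by (metis mod_diff_right_eq)

lemma periodic_comp: "periodic f \<Longrightarrow> periodic (\<lambda>x. h (f x))"
  by (simp add: periodic_def)

lemma periodic_comp2: "periodic f \<Longrightarrow> periodic g \<Longrightarrow> periodic (\<lambda>x. h (f x) (g x))"
  by (simp add: periodic_def)

lemma periodic_sum: "(\<And>i. i \<in> I \<Longrightarrow> periodic (f i)) \<Longrightarrow> periodic (\<lambda>x. \<Sum>i\<in>I. f i x)"
  by (simp add: periodic_def)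

lemma sum_shift:
  assumes "periodic f" shows "(\<Sum>x\<in>G. f (x + c)) = (\<Sum>x\<in>G. f x)"
  by (rule sum.reindex_bij_witness[of _ "\<lambda>x. (x - c) mod int p" "\<lambda>x. (x + c) mod int p"])
    (auto simp: mod_simps periodic_mod[OF assms])

lemma sum_diff:
  assumes "periodic f" shows "(\<Sum>x\<in>G. f (x - c)) = (\<Sum>x\<in>G. f x)"
  using sum_shift[OF assms, of "-c"] by simp

lemma sum_reflect:
  assumes "periodic f" shows "(\<Sum>x\<in>G. f (c - x)) = (\<Sum>x\<in>G. f x)"
  by (rule sum.reindex_bij_witness[of _ "\<lambda>x. (c - x) mod int p" "\<lambda>x. (c - x) mod int p"])
    (auto simp: mod_simps periodic_mod[OF assms])

section \<open>Counting residues and convolving over one period\<close>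

definition indic :: "int set \<Rightarrow> int \<Rightarrow> real"
  where "indic X x = of_bool (x \<in> X)"

definition periodic_set :: "int set \<Rightarrow> bool"
  where "periodic_set X \<longleftrightarrow> periodic (\<lambda>x. x \<in> X)"

definition card_mod :: "int set \<Rightarrow> real"
  where "card_mod X = (\<Sum>x\<in>G. indic X x)"

definition conv :: "(int \<Rightarrow> real) \<Rightarrow> (int \<Rightarrow> real) \<Rightarrow> int \<Rightarrow> real"
  where "conv f g z = (\<Sum>x\<in>G. f x * g (z - x))"

lemma card_mod_eq_card: "card_mod X = real (card (X \<inter> G))"
proof -
  have "card_mod X = real (card {x \<in> G. x \<in> X})"
    unfolding card_mod_def indic_def by (simp flip: sum.inter_filter add: of_bool_def)
  moreover have "{x \<in> G. x \<in> X} = X \<inter> G" by auto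
  ultimately show ?thesis by simp
qed

lemma card_mod_nonneg [simp]: "0 \<le> card_mod X"
  by (simp add: card_mod_eq_card)

lemma card_G [simp]: "card G = p"
  by simp

lemma card_mod_le_p: "card_mod X \<le> real p"
  using card_mono[of G "X \<inter> G"] by (simp add: card_mod_eq_card)

lemma card_mod_mono: "X \<subseteq> Y \<Longrightarrow> card_mod X \<le> card_mod Y"
  unfolding card_mod_def indic_def by (intro sum_mono) auto

lemma card_mod_Un_Int: "card_mod (X \<union> Y) + card_mod (X \<inter> Y) = card_mod X + card_mod Y"
  unfolding card_mod_def sum.distrib[symmetric] by (intro sum.cong refl) (auto simp: indic_def)

lemma card_mod_empty [simp]: "card_mod {} = 0"
  by (simp add: card_mod_def indic_def)

lemma card_mod_Diff:
  assumes "Y \<subseteq> X" shows "card_mod (X - Y) = card_mod X - card_mod Y"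
proof -
  have "(X - Y) \<union> Y = X" "(X - Y) \<inter> Y = {}" using assms by auto
  then show ?thesis using card_mod_Un_Int[of "X - Y" Y] by simp
qed

lemma indic_nonneg [simp]: "0 \<le> indic X x" and indic_le_1 [simp]: "indic X x \<le> 1"
  by (auto simp: indic_def)

lemma periodic_indic: "periodic_set X \<Longrightarrow> periodic (indic X)"
  unfolding periodic_set_def periodic_def indic_def by simp

lemma conv_periodic: "periodic g \<Longrightarrow> periodic (conv f g)"
  unfolding conv_def by (intro periodic_sum periodic_comp[of _ "\<lambda>y. _ * y"] periodic_diff)

lemma conv_commute:
  assumes "periodic f" "periodic g" shows "conv f g z = conv g f z"
proof -
  have "periodic (\<lambda>x. f x * g (z - x))"
    using assms by (intro periodic_comp2[of _ _ "(*)"] periodic_reflect)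
  from sum_reflect[OF this, of z] show ?thesis
    unfolding conv_def by (simp add: mult.commute)
qed

lemma sum_conv:
  assumes "periodic g" shows "(\<Sum>z\<in>G. conv f g z) = (\<Sum>x\<in>G. f x) * (\<Sum>x\<in>G. g x)"
  unfolding conv_def
  by (subst sum.swap) (simp add: sum_diff[OF assms] flip: sum_distrib_left sum_distrib_right)

lemma conv_mono:
  "(\<And>x. 0 \<le> f x) \<Longrightarrow> (\<And>x. f x \<le> f' x) \<Longrightarrow> (\<And>x. 0 \<le> g x) \<Longrightarrow> (\<And>x. g x \<le> g' x)
    \<Longrightarrow> conv f g z \<le> conv f' g' z"
  unfolding conv_def by (intro sum_mono mult_mono) (auto intro: order_trans)

lemma conv_nonneg: "(\<And>x. 0 \<le> f x) \<Longrightarrow> (\<And>x. 0 \<le> g x) \<Longrightarrow> 0 \<le> conv f g z"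
  unfolding conv_def by (simp add: sum_nonneg)

lemma conv_le_sum_right:
  assumes "periodic g" "\<And>x. f x \<le> 1" "\<And>x. 0 \<le> g x"
  shows "conv f g z \<le> (\<Sum>x\<in>G. g x)"
proof -
  have "conv f g z \<le> (\<Sum>x\<in>G. g (z - x))"
    unfolding conv_def using assms mult_right_mono[OF assms(2) assms(3)] by (intro sum_mono) auto
  then show ?thesis using sum_reflect[OF assms(1)] by simp
qed

text \<open>The shift \<open>d\<close> is invertible modulo p, so its multiples added to one point
  of \<open>X\<close> meet every residue class. This is how primality enters Pollard's
  theorem.\<close>

lemma subset_closed_UNIV:
  assumes X: "periodic_set X" "X \<noteq> {}" and d: "\<not> int p dvd d" and cl: "\<And>x. x \<in> X \<Longrightarrow> x + d \<in> X"
  shows "X = UNIV"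
proof -
  obtain x0 where x0: "x0 \<in> X" using X by blast
  have st: "x0 + int n * d \<in> X" for n
  proof (induction n)
    case (Suc n)
    then show ?case using cl[of "x0 + int n * d"] by (simp add: algebra_simps)
  qed (use x0 in simp)
  have "coprime d (int p)"
    using d prime_p by (metis coprime_commute prime_imp_coprime prime_nat_int_transfer)
  then obtain b where b: "[d * b = 1] (mod int p)" using cong_solve_coprime_int by blast
  have "w \<in> X" for w
  proof -
    define n where "n = nat ((b * (w - x0)) mod int p)"
    have n: "int n = (b * (w - x0)) mod int p" unfolding n_def by simp
    have "[x0 + int n * d = x0 + (w - x0) * (d * b)] (mod int p)"
    proof -
      have "[x0 + int n * d = x0 + (b * (w - x0)) * d] (mod int p)"
        unfolding n by (intro cong_add cong_mult cong_refl) (simp add: cong_def)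
      then show ?thesis by (simp add: algebra_simps)
    qed
    also have "[x0 + (w - x0) * (d * b) = x0 + (w - x0) * 1] (mod int p)"
      by (intro cong_add cong_refl cong_mult b)
    finally have "(x0 + int n * d) mod int p = w mod int p" by (simp add: cong_def)
    then show ?thesis
      using st[of n] periodic_cong[OF X(1)[unfolded periodic_set_def], of "x0 + int n * d" w] by simp
  qed
  then show ?thesis by blast
qed

text \<open>Strong induction on the number of residues in \<open>Y\<close> by the Dyson transform:
  \<open>X\<close> and a translate \<open>Ye e\<close> are replaced by their union and intersection,
  or by what remains of each outside the intersection. Both new second sets are smaller as soon as
  the translate meets \<open>X\<close> without lying in it. If no translate does so, either
  \<open>X\<close> is stable under a nonzero difference of elements of \<open>Y\<close>, or
  \<open>Y\<close> is a single class.\<close>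

theorem pollard:
  assumes "periodic_set X" "periodic_set Y" "real t \<le> card_mod X" "real t \<le> card_mod Y"
  shows "real t * min (real p) (card_mod X + card_mod Y - real t)
    \<le> (\<Sum>z\<in>G. min (real t) (conv (indic X) (indic Y) z))"
  using assms
proof (induction "card (Y \<inter> G)" arbitrary: X Y t rule: less_induct)
  case less
  note pX = \<open>periodic_set X\<close> and pY = \<open>periodic_set Y\<close>
  define Ye where "Ye e = {y. y - e \<in> Y}" for e
  have pYe: "periodic_set (Ye e)" for e
    using periodic_diff[of "\<lambda>x. x \<in> Y" e] pY unfolding periodic_set_def Ye_def by simp
  have szYe: "card_mod (Ye e) = card_mod Y" for e
    using sum_diff[OF periodic_indic[OF pY], of e] unfolding card_mod_def indic_def Ye_def by simp
  show ?case
  proof (cases "t = 0")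
    case True
    then show ?thesis by (simp add: conv_nonneg sum_nonneg)
  next
    case False
    then have t1: "t \<ge> 1" by simp
    have Xne: "X \<noteq> {}" and YG: "Y \<inter> G \<noteq> {}"
      using t1 less.prems by (auto simp: card_mod_eq_card)
    show ?thesis
    proof (cases "\<exists>e. X \<inter> Ye e \<noteq> {} \<and> \<not> Ye e \<subseteq> X")
      case True
      then obtain e where e: "X \<inter> Ye e \<noteq> {}" "\<not> Ye e \<subseteq> X" by blast
      define I U X' Y' where "I = X \<inter> Ye e" and "U = X \<union> Ye e"
        and "X' = X - I" and "Y' = Ye e - I"
      note defs = this
      have ps: "periodic_set I" "periodic_set U" "periodic_set X'" "periodic_set Y'"
        using pX pYe[of e] unfolding defs periodic_set_def periodic_def by auto
      have "card_mod U + card_mod I = card_mod X + card_mod (Ye e)" "card_mod X' = card_mod X - card_mod I" "card_mod Y' = card_mod (Ye e) - card_mod I"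
        unfolding defs by (rule card_mod_Un_Int card_mod_Diff Int_lower1 Int_lower2)+
      then have szU: "card_mod U = card_mod X + card_mod Y - card_mod I" and szX': "card_mod X' = card_mod X - card_mod I"
        and szY': "card_mod Y' = card_mod Y - card_mod I"
        using szYe[of e] by linarith+
      obtain y0 where "y0 \<in> Ye e" "y0 \<notin> X" using e by blast
      then have y0: "y0 mod int p \<in> Ye e \<inter> G" "y0 mod int p \<notin> X"
        using pX pYe[of e] unfolding periodic_set_def periodic_def by auto
      obtain i0 where "i0 \<in> I" using e unfolding defs by blast
      then have i0: "i0 mod int p \<in> I \<inter> G" using ps unfolding periodic_set_def periodic_def by auto
      have cYe: "card (Ye e \<inter> G) = card (Y \<inter> G)"
        using szYe[of e] by (simp add: card_mod_eq_card)
      have "card (I \<inter> G) < card (Ye e \<inter> G)"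
      proof (rule psubset_card_mono)
        show "I \<inter> G \<subset> Ye e \<inter> G" using y0 unfolding defs by blast
      qed simp
      then have cI: "card (I \<inter> G) < card (Y \<inter> G)" using cYe by simp
      have "card (Y' \<inter> G) < card (Ye e \<inter> G)"
      proof (rule psubset_card_mono)
        show "Y' \<inter> G \<subset> Ye e \<inter> G" using i0 unfolding defs by blast
      qed simp
      then have cY': "card (Y' \<inter> G) < card (Y \<inter> G)" using cYe by simp
      \<comment> \<open>The pairs split into X times I, I times Y' and X' times Y'. After exchanging
        the factors of the middle one, the first two merge because U is the disjoint union of X and
        Y'.\<close>
      have Rdec: "conv (indic X) (indic Y) (z - e) = conv (indic U) (indic I) z + conv (indic X') (indic Y') z" for z
      proof -
        have "conv (indic X) (indic Y) (z - e) = conv (indic X) (indic (Ye e)) z"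
          unfolding conv_def indic_def Ye_def by (simp add: algebra_simps)
        also have "\<dots> = conv (indic X) (indic I) z + conv (indic I) (indic Y') z + conv (indic X') (indic Y') z"
          unfolding conv_def defs indic_def sum.distrib[symmetric]
          by (intro sum.cong refl) (auto simp: of_bool_def)
        also have "conv (indic I) (indic Y') z = conv (indic Y') (indic I) z"
          using ps by (intro conv_commute periodic_indic)
        also have "conv (indic X) (indic I) z + conv (indic Y') (indic I) z = conv (indic U) (indic I) z"
          unfolding conv_def defs indic_def sum.distrib[symmetric]
          by (intro sum.cong refl) (auto simp: of_bool_def)
        finally show ?thesis .
      qed
      have "(\<Sum>z\<in>G. min (real t) (conv (indic X) (indic Y) z))
          = (\<Sum>z\<in>G. min (real t) (conv (indic X) (indic Y) (z - e)))"
        by (intro sum_diff[symmetric] periodic_comp[of _ "min (real t)"] conv_periodic periodic_indic pY)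
      then have S: "(\<Sum>z\<in>G. min (real t) (conv (indic X) (indic Y) z))
          = (\<Sum>z\<in>G. min (real t) (conv (indic U) (indic I) z + conv (indic X') (indic Y') z))"
        by (simp add: Rdec)
      show ?thesis
      proof (cases "real t \<le> card_mod I")
        case True
        have "real t * min (real p) (card_mod U + card_mod I - real t)
            \<le> (\<Sum>z\<in>G. min (real t) (conv (indic U) (indic I) z))"
        proof (intro less.hyps cI ps True)
          have "card_mod I \<le> card_mod U" by (rule card_mod_mono) (auto simp: defs)
          then show "real t \<le> card_mod U" using True by linarith
        qed
        also have "\<dots> \<le> (\<Sum>z\<in>G. min (real t) (conv (indic U) (indic I) z + conv (indic X') (indic Y') z))"
          by (intro sum_mono min.mono) (auto simp: conv_nonneg)
        finally show ?thesis using S szU by simp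
      next
        case False
        \<comment> \<open>The intersection is too small for the level t. The pair U, I contributes
          at most i for each z and is counted in full; the induction hypothesis for X', Y' supplies
          the remaining t - i.\<close>
        define i where "i = card (I \<inter> G)"
        have i: "card_mod I = real i" by (simp add: i_def card_mod_eq_card)
        then have it: "i < t" using False by simp
        have "real (t - i) * min (real p) (card_mod X' + card_mod Y' - real (t - i))
            \<le> (\<Sum>z\<in>G. min (real (t - i)) (conv (indic X') (indic Y') z))"
          using less.prems it i szX' szY' by (intro less.hyps cY' ps) auto
        \<comment> \<open>X' and Y' are disjoint, which resolves the minimum with p in the induction
          hypothesis.\<close>
        moreover have "card_mod X' + card_mod Y' \<le> real p"
        proof -
          have "card_mod X' + card_mod Y' = (\<Sum>x\<in>G. indic X' x + indic Y' x)"
            by (simp add: card_mod_def sum.distrib)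
          also have "\<dots> \<le> (\<Sum>x\<in>G. 1)" by (intro sum_mono) (auto simp: indic_def defs)
          finally show ?thesis by simp
        qed
        ultimately have 1: "real (t - i) * (card_mod X' + card_mod Y' - real (t - i))
            \<le> (\<Sum>z\<in>G. min (real (t - i)) (conv (indic X') (indic Y') z))"
          by (simp add: min_absorb2)
        have Ri: "conv (indic U) (indic I) z \<le> real i" for z
          using conv_le_sum_right[of "indic I" "indic U"] ps i by (simp add: periodic_indic card_mod_def)
        have "(\<Sum>z\<in>G. conv (indic U) (indic I) z + min (real (t - i)) (conv (indic X') (indic Y') z))
            \<le> (\<Sum>z\<in>G. min (real t) (conv (indic U) (indic I) z + conv (indic X') (indic Y') z))"
        proof (intro sum_mono)
          fix z
          show "conv (indic U) (indic I) z + min (real (t - i)) (conv (indic X') (indic Y') z)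
            \<le> min (real t) (conv (indic U) (indic I) z + conv (indic X') (indic Y') z)"
            using it Ri[of z] by (simp add: min_def of_nat_diff)
        qed
        moreover have "(\<Sum>z\<in>G. conv (indic U) (indic I) z) = card_mod U * card_mod I"
          using ps by (simp add: sum_conv periodic_indic card_mod_def)
        ultimately have "card_mod U * card_mod I + real (t - i) * (card_mod X' + card_mod Y' - real (t - i))
            \<le> (\<Sum>z\<in>G. min (real t) (conv (indic X) (indic Y) z))"
          using 1 S by (simp add: sum.distrib)
        moreover have "card_mod U * card_mod I + real (t - i) * (card_mod X' + card_mod Y' - real (t - i))
            = real t * (card_mod X + card_mod Y - real t)"
          using it unfolding szU szX' szY' i by (simp add: of_nat_diff algebra_simps)
        moreover have "real t * min (real p) (card_mod X + card_mod Y - real t)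
            \<le> real t * (card_mod X + card_mod Y - real t)"
          by (intro mult_left_mono) auto
        ultimately show ?thesis by linarith
      qed
    next
      case False
      show ?thesis
      proof (cases "\<exists>y\<in>Y. \<exists>y'\<in>Y. \<not> int p dvd (y - y')")
        case True
        then obtain y y' where y: "y \<in> Y" "y' \<in> Y" "\<not> int p dvd (y - y')" by blast
        \<comment> \<open>The translate of Y taking y' to x meets X, hence lies inside X, and it
          contains x + (y - y').\<close>
        have "x + (y - y') \<in> X" if "x \<in> X" for x
        proof -
          have "x \<in> Ye (x - y')" using y by (simp add: Ye_def)
          then have "Ye (x - y') \<subseteq> X" using False that by blast
          moreover have "x + (y - y') \<in> Ye (x - y')" using y by (simp add: Ye_def)
          ultimately show ?thesis by blast
        qed
        from subset_closed_UNIV[OF pX Xne y(3) this] have "X = UNIV" by blast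
        then have "conv (indic X) (indic Y) z = card_mod Y" for z
          using sum_reflect[OF periodic_indic[OF pY], of z] by (simp add: conv_def indic_def card_mod_def)
        then have "(\<Sum>z\<in>G. min (real t) (conv (indic X) (indic Y) z)) = real t * real p"
          using less.prems by simp
        then show ?thesis by (simp add: mult_left_mono)
      next
        case False
        obtain y where y: "y \<in> Y" "y \<in> G" using YG by blast
        have YG1: "Y \<inter> G = {y}"
        proof -
          have "x = y" if "x \<in> Y" "x \<in> G" for x
          proof -
            have "x mod int p = y mod int p"
              using False that y mod_eq_dvd_iff by blast
            then show ?thesis using that y by simp
          qed
          then show ?thesis using y by blast
        qed
        then have szY: "card_mod Y = 1" by (simp add: card_mod_eq_card)
        then have t: "t = 1" using less.prems t1 by simp
        have "conv (indic X) (indic Y) z = indic X (z - y)" for z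
        proof -
          have "conv (indic X) (indic Y) z = conv (indic Y) (indic X) z"
            using pX pY by (intro conv_commute periodic_indic)
          also have "\<dots> = (\<Sum>x\<in>G. if x = y then indic X (z - x) else 0)"
            unfolding conv_def
          proof (intro sum.cong refl)
            fix x assume "x \<in> G"
            then have "x \<in> Y \<longleftrightarrow> x = y" using YG1 by blast
            then show "indic Y x * indic X (z - x) = (if x = y then indic X (z - x) else 0)"
              by (simp add: indic_def)
          qed
          finally show ?thesis using y by simp
        qed
        then have "(\<Sum>z\<in>G. min (real t) (conv (indic X) (indic Y) z)) = (\<Sum>z\<in>G. indic X (z - y))"
          using t by simp
        also have "\<dots> = card_mod X" using sum_diff[OF periodic_indic[OF pX]] by (simp add: card_mod_def)
        finally show ?thesis using t szY by simp
      qed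
    qed
  qed
qed

end

section \<open>Almost-periods of convolutions\<close>

text \<open>Eighth powers: e^5 <= 3^5 = 243 < 256 = 2^8.\<close>

lemma exp_5_8_le_2: "exp (5/8 :: real) \<le> 2"
proof -
  have "exp (5/8 :: real) ^ 8 = exp 1 ^ 5"
    by (simp flip: exp_of_nat_mult)
  also have "\<dots> \<le> 3 ^ 5" using exp_le by (intro power_mono) auto
  also have "\<dots> \<le> (2 :: real) ^ 8" by simp
  finally have "exp (5/8 :: real) ^ 8 \<le> 2 ^ 8" .
  then show ?thesis by (subst (asm) power_mono_iff) auto
qed

lemma two_le_exp_3_4: "(2 :: real) \<le> exp (3/4)"
proof -
  have "(2 :: real) \<le> 1 + 3/4 + (3/4)^2 / 2" by (simp add: power2_eq_square)
  also have "\<dots> \<le> exp (3/4)" by (rule exp_lower_Taylor_quadratic) simp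
  finally show ?thesis .
qed

text \<open>The tail exponents below are m (1 - 2 ln 2) and m (ln 2 - 1). They are negative because
  1/2 < ln 2 < 1, and these two bounds leave enough room for the common rate 1/8.\<close>

lemma ln_2_bounds: "5/8 \<le> ln (2::real)" "ln (2::real) \<le> 3/4"
proof -
  show "5/8 \<le> ln (2::real)" using exp_5_8_le_2 by (subst ln_ge_iff) auto
  have "ln (2::real) \<le> ln (exp (3/4))" using two_le_exp_3_4 by (subst ln_le_cancel_iff) auto
  then show "ln (2::real) \<le> 3/4" by simp
qed

lemma ex_large_fibre:
  assumes "finite S" "finite Q" "Q \<noteq> {}" "f ` S \<subseteq> Q"
  shows "\<exists>c\<in>Q. real (card S) \<le> real (card Q) * real (card {x\<in>S. f x = c})"
proof (rule ccontr)
  assume "\<not> ?thesis"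
  then have less: "real (card Q) * real (card {x\<in>S. f x = c}) < real (card S)" if "c \<in> Q" for c
    using that by force
  have "real (card S) = (\<Sum>c\<in>Q. real (card {x\<in>S. f x = c}))"
    using sum.group[OF assms(1,2,4), of "\<lambda>_. 1::real"] by simp
  then have "real (card Q) * real (card S) = (\<Sum>c\<in>Q. real (card Q) * real (card {x\<in>S. f x = c}))"
    by (simp add: sum_distrib_left)
  also have "\<dots> < (\<Sum>c\<in>Q. real (card S))"
    using less assms by (intro sum_strict_mono) auto
  finally show False by simp
qed

context prime_modulus begin

section \<open>Chernoff bounds for random tuples\<close>

definition hits :: "int set \<Rightarrow> nat \<Rightarrow> (nat \<Rightarrow> int) \<Rightarrow> int \<Rightarrow> nat"
  where "hits A k b z = card {i \<in> {..<k}. z - b i \<in> A}"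

text \<open>Up to the factor n^k this is the moment generating function of a binomial variable: the
  entries of the tuple are independent and uniform on n residues, and each hits with probability
  conv/n. The sum over tuples factors over coordinates, and 1 + y <= exp y does the rest.\<close>

lemma hits_moment:
  assumes "0 < x" "card (B \<inter> G) = n" "0 < n"
  shows "(\<Sum>b\<in>{..<k} \<rightarrow>\<^sub>E B \<inter> G. x ^ hits A k b z)
    \<le> real n ^ k * exp ((x - 1) * (real k * conv (indic B) (indic A) z / real n))"
proof -
  define h where "h y = (if z - y \<in> A then x else 1)" for y
  have f: "conv (indic B) (indic A) z = (\<Sum>y\<in>B \<inter> G. indic A (z - y))"
    unfolding conv_def by (intro sum.mono_neutral_cong_right) (auto simp: indic_def)
  have "(\<Sum>y\<in>B \<inter> G. h y) = (\<Sum>y\<in>B \<inter> G. 1 + (x - 1) * indic A (z - y))"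
    by (intro sum.cong) (auto simp: h_def indic_def)
  also have "\<dots> = real n + (x - 1) * conv (indic B) (indic A) z"
    unfolding f sum.distrib sum_distrib_left[symmetric] using assms by simp
  also have "\<dots> = real n * (1 + (x - 1) * (conv (indic B) (indic A) z / real n))"
    using assms by (simp add: field_simps)
  also have "\<dots> \<le> real n * exp ((x - 1) * (conv (indic B) (indic A) z / real n))"
    by (intro mult_left_mono exp_ge_add_one_self) auto
  finally have h: "(\<Sum>y\<in>B \<inter> G. h y) \<le> real n * exp ((x - 1) * (conv (indic B) (indic A) z / real n))" .
  have "x ^ hits A k b z = (\<Prod>i<k. h (b i))" for b
    unfolding hits_def h_def by (simp add: prod.If_cases Int_def)
  then have "(\<Sum>b\<in>{..<k} \<rightarrow>\<^sub>E B \<inter> G. x ^ hits A k b z) = (\<Prod>i<k. \<Sum>y\<in>B \<inter> G. h y)"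
    by (subst prod_sum_PiE) auto
  also have "\<dots> = (\<Sum>y\<in>B \<inter> G. h y) ^ k" by simp
  also have "\<dots> \<le> (real n * exp ((x - 1) * (conv (indic B) (indic A) z / real n))) ^ k"
    using assms by (intro power_mono h sum_nonneg) (auto simp: h_def)
  finally show ?thesis
    by (simp add: power_mult_distrib algebra_simps flip: exp_of_nat_mult)
qed

text \<open>Here \<open>e\<close> is the prediction of the convolution \<open>f\<close> by the
  sample \<open>b\<close>. Only agreement up to a factor 2 is asked, and none once both are at most
  2 M; with this relative notion about n/M samples suffice, up to a logarithm.\<close>

definition atypical :: "int set \<Rightarrow> int set \<Rightarrow> real \<Rightarrow> nat \<Rightarrow> (nat \<Rightarrow> int) \<Rightarrow> int \<Rightarrow> bool"
  where "atypical A B M k b z \<longleftrightarrow>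
    (let f = conv (indic B) (indic A) z; e = card_mod B * real (hits A k b z) / real k
     in e > 2 * max f M \<or> f > 2 * max e M)"

text \<open>Markov's inequality for 2^hits. The number \<open>m\<close> is the mean number of hits
  after f has been raised to at least M, and the event forces at least 2 m hits.\<close>

lemma card_upper_tail:
  assumes k: "0 < k" and n: "card (B \<inter> G) = n" "0 < n" and M: "0 \<le> M"
  shows "real (card {b \<in> {..<k} \<rightarrow>\<^sub>E B \<inter> G.
      real n * real (hits A k b z) / real k > 2 * max (conv (indic B) (indic A) z) M})
    \<le> real n ^ k * exp (- real k * M / (8 * real n))" (is "real (card ?S) \<le> _")
proof -
  define f where "f = conv (indic B) (indic A) z"
  define m where "m = real k * max f M / real n"
  have fin: "finite ({..<k} \<rightarrow>\<^sub>E B \<inter> G)" by (intro finite_PiE) auto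
  have f0: "f \<ge> 0" unfolding f_def by (simp add: conv_nonneg)
  have "exp (2 * m * ln 2) * real (card ?S) = (\<Sum>b\<in>?S. exp (2 * m * ln 2))" by simp
  also have "\<dots> \<le> (\<Sum>b\<in>?S. 2 ^ hits A k b z)"
  proof (intro sum_mono)
    fix b assume "b \<in> ?S"
    then have "2 * max f M < real n * real (hits A k b z) / real k" unfolding f_def by blast
    then have "2 * m \<le> real (hits A k b z)"
      unfolding m_def using k n by (simp add: field_simps)
    then have "exp (2 * m * ln 2) \<le> exp (real (hits A k b z) * ln 2)" by simp
    then show "exp (2 * m * ln 2) \<le> 2 ^ hits A k b z" by (simp add: exp_of_nat_mult)
  qed
  also have "\<dots> \<le> (\<Sum>b\<in>{..<k} \<rightarrow>\<^sub>E B \<inter> G. 2 ^ hits A k b z)"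
    by (intro sum_mono2 fin) auto
  also have "\<dots> \<le> real n ^ k * exp ((2 - 1) * (real k * f / real n))"
    unfolding f_def by (intro hits_moment n) auto
  also have "\<dots> \<le> real n ^ k * exp m"
    unfolding m_def by (intro mult_left_mono) (auto intro!: divide_right_mono mult_left_mono)
  finally have "real (card ?S) \<le> real n ^ k * (exp m / exp (2 * m * ln 2))"
    by (simp add: field_simps)
  also have "\<dots> = real n ^ k * exp (m * (1 - 2 * ln 2))"
    by (simp add: algebra_simps flip: exp_diff)
  also have "m * (1 - 2 * ln 2) \<le> m * (- 1/8)"
    using ln_2_bounds f0 by (intro mult_left_mono) (auto simp: m_def)
  also have "m * (- 1/8) \<le> - real k * M / (8 * real n)"
  proof -
    have "real k * M / real n \<le> m"
      unfolding m_def by (intro divide_right_mono mult_left_mono) auto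
    then show ?thesis by simp
  qed
  finally show ?thesis by (simp add: mult_left_mono)
qed

text \<open>The same with (1/2)^hits, where \<open>m\<close> is now half the mean. For f <= 2 M the
  event cannot occur; otherwise decay in terms of f is at least as good as decay in terms of
  M.\<close>

lemma card_lower_tail:
  assumes k: "0 < k" and n: "card (B \<inter> G) = n" "0 < n" and M: "0 \<le> M"
  shows "real (card {b \<in> {..<k} \<rightarrow>\<^sub>E B \<inter> G.
      conv (indic B) (indic A) z > 2 * max (real n * real (hits A k b z) / real k) M})
    \<le> real n ^ k * exp (- real k * M / (8 * real n))" (is "real (card ?S) \<le> _")
proof (cases "conv (indic B) (indic A) z > 2 * M")
  case False
  have "\<not> 2 * max e M < conv (indic B) (indic A) z" for e
    using False by (simp add: max_def)
  then have "?S = {}" by blast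
  then show ?thesis by (simp only: card.empty) simp
next
  case True
  define f where "f = conv (indic B) (indic A) z"
  define m where "m = real k * f / (2 * real n)"
  have fin: "finite ({..<k} \<rightarrow>\<^sub>E B \<inter> G)" by (intro finite_PiE) auto
  have f0: "f \<ge> 0" unfolding f_def by (simp add: conv_nonneg)
  have "exp (- m * ln 2) * real (card ?S) = (\<Sum>b\<in>?S. exp (- m * ln 2))" by simp
  also have "\<dots> \<le> (\<Sum>b\<in>?S. (1/2) ^ hits A k b z)"
  proof (intro sum_mono)
    fix b assume "b \<in> ?S"
    then have "2 * max (real n * real (hits A k b z) / real k) M < f" unfolding f_def by blast
    then have "2 * (real n * real (hits A k b z) / real k) < f" by linarith
    then have "real (hits A k b z) \<le> m"
      unfolding m_def using k n by (simp add: field_simps)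
    then have "exp (- m * ln 2) \<le> exp (- (real (hits A k b z) * ln 2))" by simp
    then show "exp (- m * ln 2) \<le> (1/2) ^ hits A k b z"
      by (simp add: exp_minus exp_of_nat_mult power_divide inverse_eq_divide)
  qed
  also have "\<dots> \<le> (\<Sum>b\<in>{..<k} \<rightarrow>\<^sub>E B \<inter> G. (1/2) ^ hits A k b z)"
    by (intro sum_mono2 fin) auto
  also have "\<dots> \<le> real n ^ k * exp ((1/2 - 1) * (real k * f / real n))"
    unfolding f_def by (intro hits_moment n) auto
  also have "\<dots> = real n ^ k * exp (- m)"
    unfolding m_def by simp
  finally have "real (card ?S) \<le> real n ^ k * (exp (- m) / exp (- m * ln 2))"
    by (simp add: field_simps)
  also have "\<dots> = real n ^ k * exp (m * (ln 2 - 1))"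
    by (simp add: algebra_simps flip: exp_diff)
  also have "m * (ln 2 - 1) \<le> m * (- 1/4)"
    using ln_2_bounds f0 by (intro mult_left_mono) (auto simp: m_def)
  also have "m * (- 1/4) \<le> - real k * M / (8 * real n)"
  proof -
    have "real k * M / (8 * real n) \<le> real k * f / (8 * real n)"
      using True M unfolding f_def by (intro divide_right_mono mult_left_mono) auto
    then show ?thesis unfolding m_def by simp
  qed
  finally show ?thesis by (simp add: mult_left_mono)
qed

lemma periodic_set_atypical:
  assumes "periodic_set A" shows "periodic_set {z. atypical A B M k b z}"
proof -
  have "conv (indic B) (indic A) (z mod int p) = conv (indic B) (indic A) z"
    and "hits A k b (z mod int p) = hits A k b z" for z
    using periodic_mod[OF conv_periodic[OF periodic_indic[OF assms]]] periodic_mod[OF periodic_diff[OF assms[unfolded periodic_set_def]]]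
    by (simp_all add: hits_def)
  then show ?thesis unfolding periodic_set_def periodic_def atypical_def by simp
qed

text \<open>Sampling as in Croot and Sisask: most \<open>k\<close>-tuples from \<open>B\<close> predict the convolution \<open>conv (indic B) (indic A)\<close>
  well, so two translates of one tuple that are both good predictors force \<open>s - t\<close> to be
  an almost-period.\<close>

lemma almost_periods:
  assumes A: "periodic_set A" and n: "card (B \<inter> G) = n" "0 < n" and k: "0 < k" and M: "0 \<le> M"
  obtains T where "T \<subseteq> G" "real p * (real n / real p) ^ k / 2 \<le> real (card T)"
    "\<And>s t. s \<in> T \<Longrightarrow> t \<in> T \<Longrightarrow>
      card_mod {z. conv (indic B) (indic A) (z - s + t) > 4 * max (conv (indic B) (indic A) z) M}
        \<le> 8 * exp (- real k * M / (8 * real n)) * real p"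
proof -
  define E where "E = exp (- real k * M / (8 * real n))"
  define f where "f = conv (indic B) (indic A)"
  let ?P = "{..<k} \<rightarrow>\<^sub>E B \<inter> G"
  let ?Q = "{..<k} \<rightarrow>\<^sub>E G"
  have szB: "card_mod B = real n" using n by (simp add: card_mod_eq_card)
  have fin: "finite ?P" "finite ?Q" by (intro finite_PiE; auto)+
  have cP: "card ?P = n ^ k" and cQ: "card ?Q = p ^ k" by (simp_all add: card_PiE n)
  define L where "L = {b \<in> ?P. card_mod {z. atypical A B M k b z} \<le> 4 * E * real p}"
  \<comment> \<open>Double counting: the tail bounds apply for each position z. On average a tuple
    has at most 2 E p atypical positions, so by Markov's inequality at least half of the tuples
    belong to L.\<close>
  have "(\<Sum>b\<in>?P. card_mod {z. atypical A B M k b z})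
      = (\<Sum>z\<in>G. real (card {b\<in>?P. atypical A B M k b z}))"
    unfolding card_mod_def indic_def
    by (subst sum.swap) (use fin in \<open>simp flip: sum.inter_filter add: of_bool_def\<close>)
  also have "\<dots> \<le> (\<Sum>z\<in>G. 2 * (real n ^ k * E))"
  proof (intro sum_mono)
    fix z
    have "{b\<in>?P. atypical A B M k b z} =
      {b \<in> ?P. real n * real (hits A k b z) / real k > 2 * max (conv (indic B) (indic A) z) M} \<union>
      {b \<in> ?P. conv (indic B) (indic A) z > 2 * max (real n * real (hits A k b z) / real k) M}"
      unfolding atypical_def Let_def szB by blast
    then have "real (card {b\<in>?P. atypical A B M k b z}) \<le>
      real (card {b \<in> ?P. real n * real (hits A k b z) / real k > 2 * max (conv (indic B) (indic A) z) M}) +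
      real (card {b \<in> ?P. conv (indic B) (indic A) z > 2 * max (real n * real (hits A k b z) / real k) M})"
      by (metis (no_types, lifting) card_Un_le of_nat_add of_nat_le_iff)
    also have "\<dots> \<le> real n ^ k * E + real n ^ k * E"
      unfolding E_def by (intro add_mono card_upper_tail card_lower_tail k n M)
    finally show "real (card {b\<in>?P. atypical A B M k b z}) \<le> 2 * (real n ^ k * E)" by linarith
  qed
  finally have tot: "(\<Sum>b\<in>?P. card_mod {z. atypical A B M k b z}) \<le> 2 * real n ^ k * E * real p"
    by (simp add: algebra_simps)
  have E0: "E > 0" by (simp add: E_def)
  have LP: "L \<subseteq> ?P" unfolding L_def by blast
  then have finL: "finite L" using fin(1) by (rule finite_subset)
  have cL: "real n ^ k / 2 \<le> real (card L)"
  proof -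
    have "4 * E * real p * real (card (?P - L)) = (\<Sum>b\<in>?P - L. 4 * E * real p)" by simp
    also have "\<dots> \<le> (\<Sum>b\<in>?P - L. card_mod {z. atypical A B M k b z})"
    proof (rule sum_mono)
      fix b assume "b \<in> ?P - L"
      then have "\<not> card_mod {z. atypical A B M k b z} \<le> 4 * E * real p" unfolding L_def by blast
      then show "4 * E * real p \<le> card_mod {z. atypical A B M k b z}" by linarith
    qed
    also have "\<dots> \<le> (\<Sum>b\<in>?P. card_mod {z. atypical A B M k b z})"
      using fin(1) by (rule sum_mono2) auto
    also have "\<dots> \<le> 4 * E * real p * (real n ^ k / 2)" using tot by (simp add: algebra_simps)
    finally have "real (card (?P - L)) \<le> real n ^ k / 2" using E0 by simp
    moreover have "card (?P - L) = card ?P - card L"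
      by (rule card_Diff_subset[OF finL LP])
    moreover have "card L \<le> card ?P" by (rule card_mono[OF fin(1) LP])
    ultimately show ?thesis by (simp add: cP of_nat_diff)
  qed
  \<comment> \<open>Each good tuple is translated diagonally by every residue. Among at least n^k p
    / 2 such pairs, one of the p^k possible results c is reached at least p (n/p)^k / 2 times; T
    collects the shifts that lead to it.\<close>
  define shft where "shft = (\<lambda>(b, t). \<lambda>i\<in>{..<k}. (b i - t) mod int p)"
  have "\<exists>c\<in>?Q. real (card (L \<times> G)) \<le> real (card ?Q) * real (card {x\<in>L \<times> G. shft x = c})"
  proof (rule ex_large_fibre)
    show "shft ` (L \<times> G) \<subseteq> ?Q"
      by (auto simp: shft_def PiE_def extensional_def)
  qed (use finL fin in \<open>auto simp: PiE_eq_empty_iff\<close>)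
  then obtain c where c: "c \<in> ?Q"
    "real (card (L \<times> G)) \<le> real (card ?Q) * real (card {x\<in>L \<times> G. shft x = c})" by blast
  define F where "F = {x\<in>L \<times> G. shft x = c}"
  define T where "T = snd ` F"
  have val: "(b i) mod int p = (c i + t) mod int p" if "(b, t) \<in> F" "i < k" for b t i
    using that unfolding F_def shft_def by (auto simp: mod_simps)
  have bF: "b \<in> ?P" if "(b, t) \<in> F" for b t
    using that by (auto simp: F_def L_def)
  \<comment> \<open>The tuple is recovered from c and the shift, so T is as large as the
    fibre.\<close>
  have "inj_on snd F"
  proof (rule inj_onI, clarsimp)
    fix b t b' assume bt: "(b, t) \<in> F" "(b', t) \<in> F"
    show "b = b'"
    proof (rule PiE_ext[OF bF[OF bt(1)] bF[OF bt(2)]])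
      fix i assume i: "i \<in> {..<k}"
      then have "b i mod int p = b' i mod int p" using val bt by simp
      moreover have "b i \<in> G" "b' i \<in> G" using bF bt i by blast+
      ultimately show "b i = b' i" by simp
    qed
  qed
  then have "card T = card F" by (simp add: T_def card_image)
  then have "real (card L) * real p \<le> real p ^ k * real (card T)"
    using c(2) by (simp add: cQ card_cartesian_product F_def)
  moreover have "real n ^ k / 2 * real p \<le> real (card L) * real p"
    using cL by (intro mult_right_mono) auto
  ultimately have "real n ^ k / 2 * real p \<le> real p ^ k * real (card T)" by linarith
  then have cT: "real p * (real n / real p) ^ k / 2 \<le> real (card T)"
    by (simp add: power_divide field_simps)
  have hits_eq: "hits A k b z = hits A k c (z - t)" if "(b, t) \<in> F" for b t z
  proof -
    have "z - b i \<in> A \<longleftrightarrow> z - t - c i \<in> A" if "i < k" for i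
    proof (rule periodic_cong[OF A[unfolded periodic_set_def]])
      have "(z - b i) mod int p = (z - (b i) mod int p) mod int p" by (simp add: mod_simps)
      also have "\<dots> = (z - (c i + t)) mod int p"
        using val[OF \<open>(b, t) \<in> F\<close> \<open>i < k\<close>] by (simp add: mod_simps)
      finally show "(z - b i) mod int p = (z - t - c i) mod int p" by (simp add: algebra_simps)
    qed
    then show ?thesis unfolding hits_def by (intro arg_cong[of _ _ card]) auto
  qed
  have "card_mod {z. f (z - s + t) > 4 * max (f z) M} \<le> 8 * E * real p" if st: "s \<in> T" "t \<in> T" for s t
  proof -
    obtain bs bt where b: "(bs, s) \<in> F" "(bt, t) \<in> F" using st by (auto simp: T_def)
    have bl: "bs \<in> L" "bt \<in> L" using b by (auto simp: F_def)
    let ?S = "{z. atypical A B M k bs z}" and ?T = "{z. atypical A B M k bt z}"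
    have "{z. f (z - s + t) > 4 * max (f z) M} \<subseteq> ?S \<union> {z. z - s + t \<in> ?T}"
    proof
      fix z assume "z \<in> {z. f (z - s + t) > 4 * max (f z) M}"
      then have z: "f (z - s + t) > 4 * max (f z) M" by blast
      \<comment> \<open>Both tuples are translates of c, so e is at once the prediction of the first
        at z and of the second at z - s + t. If both were typical, passing through e would give f (z
        - s + t) <= 4 max (f z) M.\<close>
      define e where "e = card_mod B * real (hits A k c (z - s)) / real k"
      have 1: "atypical A B M k bs z \<longleftrightarrow> e > 2 * max (f z) M \<or> f z > 2 * max e M"
        unfolding atypical_def Let_def f_def hits_eq[OF b(1)] e_def ..
      have 2: "atypical A B M k bt (z - s + t) \<longleftrightarrow>
          e > 2 * max (f (z - s + t)) M \<or> f (z - s + t) > 2 * max e M"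
        unfolding atypical_def Let_def f_def hits_eq[OF b(2)] e_def by simp
      have "e > 2 * max (f z) M \<or> f (z - s + t) > 2 * max e M"
        using z M by linarith
      then show "z \<in> ?S \<union> {z. z - s + t \<in> ?T}" using 1 2 by blast
    qed
    then have "card_mod {z. f (z - s + t) > 4 * max (f z) M} \<le> card_mod (?S \<union> {z. z - s + t \<in> ?T})"
      by (rule card_mod_mono)
    also have "\<dots> \<le> card_mod ?S + card_mod {z. z - s + t \<in> ?T}"
      unfolding card_mod_def sum.distrib[symmetric] by (intro sum_mono) (auto simp: indic_def)
    also have "card_mod {z. z - s + t \<in> ?T} = card_mod ?T"
      using sum_shift[OF periodic_indic[OF periodic_set_atypical[OF A, of B M k bt]], of "t - s"]
      by (simp add: card_mod_def indic_def algebra_simps)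
    finally show ?thesis using bl by (simp add: L_def)
  qed
  moreover have "T \<subseteq> G" by (auto simp: T_def F_def)
  ultimately show thesis using that cT unfolding E_def f_def by blast
qed

end

section \<open>Smoothing\<close>

lemma sum_inverse_sqrt_le: "(\<Sum>i=1..n. 1 / sqrt (real i)) \<le> 2 * sqrt (real n)"
proof (induction n)
  case (Suc n)
  define a b where "a = sqrt (real n)" and "b = sqrt (real (Suc n))"
  have b: "b > 0" "b\<^sup>2 = a\<^sup>2 + 1" "a \<ge> 0" by (simp_all add: a_def b_def)
  have "0 \<le> (b - a)\<^sup>2" by simp
  then have "2 * a * b + 1 \<le> 2 * b * b"
    using b(2) by (simp add: power2_eq_square algebra_simps)
  then have "2 * a + 1 / b \<le> 2 * b" using b(1) by (simp add: field_simps)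
  then show ?case using Suc.IH by (simp add: a_def b_def)
qed simp

text \<open>A discrete layer-cake formula: n equally spaced levels capture the sum up to a rounding
  error card S / n, which vanishes in the limit. The 2 is the integral of u^(-1/2) over (0,1]. As K
  may have either sign, the bound can be inserted into itself with respect to a second
  function.\<close>

lemma sum_le_of_level_sets:
  fixes y :: "'a \<Rightarrow> real"
  assumes S: "finite S" and y: "\<And>x. x \<in> S \<Longrightarrow> 0 \<le> y x" "\<And>x. x \<in> S \<Longrightarrow> y x \<le> 1"
    and c: "0 \<le> c"
    and lev: "\<And>u. 0 < u \<Longrightarrow> u \<le> 1 \<Longrightarrow> real (card {x \<in> S. u \<le> y x}) \<le> K + c / sqrt u"
  shows "(\<Sum>x\<in>S. y x) \<le> K + 2 * c"
proof -
  have *: "(\<Sum>x\<in>S. y x) \<le> K + 2 * c + real (card S) / real n" if n: "n \<ge> 1" for n :: nat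
  proof -
    have pt: "real n * y x \<le> (\<Sum>i=1..n. of_bool (real i / real n \<le> y x)) + 1" if "x \<in> S" for x
    proof -
      define j where "j = nat \<lfloor>real n * y x\<rfloor>"
      have j: "real j \<le> real n * y x" "real n * y x < real j + 1"
        using y[OF that] by (auto simp: j_def)
      have "real j \<le> real n * 1" using j(1) mult_left_mono[OF y(2)[OF that], of "real n"] by linarith
      then have jn: "j \<le> n" by simp
      have "real j = (\<Sum>i=1..j. 1)" by simp
      also have "\<dots> \<le> (\<Sum>i=1..j. of_bool (real i / real n \<le> y x))"
      proof (rule sum_mono)
        fix i assume "i \<in> {1..j}"
        then have "real i \<le> real n * y x" using j(1) by simp
        then have "real i / real n \<le> y x" using n by (simp add: field_simps)
        then show "(1::real) \<le> of_bool (real i / real n \<le> y x)" by simp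
      qed
      also have "\<dots> \<le> (\<Sum>i=1..n. of_bool (real i / real n \<le> y x))"
        using jn by (intro sum_mono2) auto
      finally show ?thesis using j by linarith
    qed
    have "real n * (\<Sum>x\<in>S. y x) \<le> (\<Sum>x\<in>S. (\<Sum>i=1..n. of_bool (real i / real n \<le> y x)) + 1)"
      unfolding sum_distrib_left by (intro sum_mono pt)
    also have "\<dots> = (\<Sum>i=1..n. real (card {x \<in> S. real i / real n \<le> y x})) + real (card S)"
      unfolding sum.distrib using S
      by (subst sum.swap) (simp add: of_bool_def flip: sum.inter_filter)
    also have "(\<Sum>i=1..n. real (card {x \<in> S. real i / real n \<le> y x}))
        \<le> (\<Sum>i=1..n. K + c / sqrt (real i / real n))"
      using n by (intro sum_mono lev) auto
    also have "\<dots> = real n * K + c * sqrt (real n) * (\<Sum>i=1..n. 1 / sqrt (real i))"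
      by (simp add: sum.distrib sum_distrib_left real_sqrt_divide)
    also have "\<dots> \<le> real n * K + c * sqrt (real n) * (2 * sqrt (real n))"
      using c by (intro add_left_mono mult_left_mono sum_inverse_sqrt_le) auto
    also have "\<dots> = real n * (K + 2 * c)" by (simp add: algebra_simps)
    finally have "real n * (\<Sum>x\<in>S. y x) \<le> real n * (K + 2 * c + real (card S) / real n)"
      using n by (simp add: algebra_simps)
    then show ?thesis using n by (subst (asm) mult_le_cancel_left_pos) auto
  qed
  have "(\<lambda>n. K + 2 * c + real (card S) / real n) \<longlonglongrightarrow> K + 2 * c + 0"
    by (intro tendsto_add tendsto_const lim_const_over_n)
  then have "(\<Sum>x\<in>S. y x) \<le> K + 2 * c + 0"
    using * by (intro tendsto_lowerbound[where F = sequentially])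
      (auto simp: eventually_sequentially intro: exI[of _ 1])
  then show ?thesis by simp
qed

context prime_modulus begin

text \<open>\<open>smooth T h\<close> is the convolution of \<open>h\<close> with \<open>\<mu>\<^sub>T * \<mu>\<^sub>-\<^sub>T\<close>, \<open>\<mu>\<^sub>T\<close> the uniform probability measure on \<open>T\<close>.\<close>

definition smooth :: "int set \<Rightarrow> (int \<Rightarrow> real) \<Rightarrow> int \<Rightarrow> real"
  where "smooth T h x = (\<Sum>(s, t)\<in>T \<times> T. h (x + (t - s))) / (real (card T))\<^sup>2"

lemma smooth_periodic: "periodic h \<Longrightarrow> periodic (smooth T h)"
  unfolding smooth_def case_prod_beta
  by (rule periodic_comp[of _ "\<lambda>y. y / _"], rule periodic_sum, rule periodic_shift)

lemma smooth_nonneg: "(\<And>x. 0 \<le> h x) \<Longrightarrow> 0 \<le> smooth T h x"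
  unfolding smooth_def by (intro divide_nonneg_nonneg sum_nonneg) auto

lemma smooth_le:
  assumes "finite T" "T \<noteq> {}" "\<And>x. h x \<le> c" shows "smooth T h x \<le> c"
proof -
  have "(\<Sum>(s, t)\<in>T \<times> T. h (x + (t - s))) \<le> (\<Sum>(s, t)\<in>T \<times> T. c)"
    using assms(3) by (intro sum_mono) auto
  also have "\<dots> = c * (real (card T))\<^sup>2" by (simp add: power2_eq_square card_cartesian_product)
  finally show ?thesis using assms unfolding smooth_def
    by (simp add: divide_le_eq card_gt_0_iff)
qed

lemma sum_smooth:
  assumes "finite T" "T \<noteq> {}" "periodic h" shows "(\<Sum>x\<in>G. smooth T h x) = (\<Sum>x\<in>G. h x)"
proof -
  have "(\<Sum>x\<in>G. smooth T h x) = (\<Sum>(s, t)\<in>T \<times> T. \<Sum>x\<in>G. h (x + (t - s))) / (real (card T))\<^sup>2"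
    unfolding smooth_def sum_divide_distrib[symmetric] case_prod_beta by (subst sum.swap) simp
  also have "\<dots> = (\<Sum>(s, t)\<in>T \<times> T. \<Sum>x\<in>G. h x) / (real (card T))\<^sup>2"
    unfolding sum_shift[OF assms(3)] ..
  also have "\<dots> = (\<Sum>x\<in>G. h x)"
    using assms by (simp add: power2_eq_square card_cartesian_product card_gt_0_iff)
  finally show ?thesis .
qed

lemma conv_smooth_right: "conv g (smooth T h) z = smooth T (conv g h) z"
proof -
  have "conv g (smooth T h) z = (\<Sum>x\<in>G. \<Sum>q\<in>T \<times> T. g x * h (z - x + (snd q - fst q))) / (real (card T))\<^sup>2"
    unfolding conv_def smooth_def case_prod_beta by (simp add: sum_divide_distrib sum_distrib_left)
  also have "\<dots> = (\<Sum>q\<in>T \<times> T. \<Sum>x\<in>G. g x * h (z - x + (snd q - fst q))) / (real (card T))\<^sup>2"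
    by (subst sum.swap) simp
  also have "\<dots> = smooth T (conv g h) z"
    unfolding smooth_def conv_def case_prod_beta by (simp add: algebra_simps)
  finally show ?thesis .
qed

text \<open>Smoothing is convolution with a fixed measure and moves out of either factor. Smoothing
  both sets therefore amounts to using almost-periods twice on the original convolution.\<close>

lemma conv_smooth_smooth:
  assumes "periodic g" "periodic h"
  shows "conv (smooth T g) (smooth T h) z = smooth T (smooth T (conv g h)) z"
proof -
  have "conv (smooth T g) h w = smooth T (conv g h) w" for w
  proof -
    have "conv (smooth T g) h w = smooth T (conv h g) w"
      using conv_commute[OF smooth_periodic assms(2)] assms conv_smooth_right by metis
    also have "conv h g = conv g h" by (rule ext) (rule conv_commute[OF assms(2,1)])
    finally show ?thesis .
  qed
  then have "conv (smooth T g) h = smooth T (conv g h)" by (rule ext)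
  then show ?thesis by (simp add: conv_smooth_right)
qed

text \<open>If w x counts the t in T with x + t in B, the correlation is the normalised sum of
  squares of w, and Cauchy-Schwarz compares it with the square of the sum of w.\<close>

lemma smooth_correlation:
  assumes T: "finite T" "T \<noteq> {}" and B: "periodic_set B"
  shows "(card_mod B)\<^sup>2 \<le> real p * (\<Sum>x\<in>G. indic B x * smooth T (indic B) x)"
proof -
  define w where "w x = (\<Sum>t\<in>T. indic B (x + t))" for x
  have cT: "real (card T) > 0" using T by (simp add: card_gt_0_iff)
  have w: "(\<Sum>x\<in>G. w x) = real (card T) * card_mod B"
    unfolding w_def by (subst sum.swap) (simp add: sum_shift[OF periodic_indic[OF B]] card_mod_def)
  have "(\<Sum>x\<in>G. indic B x * smooth T (indic B) x)
      = (\<Sum>q\<in>T \<times> T. \<Sum>x\<in>G. indic B x * indic B (x + (snd q - fst q))) / (real (card T))\<^sup>2"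
    unfolding smooth_def case_prod_beta
    by (subst sum.swap) (simp add: sum_divide_distrib sum_distrib_left)
  also have "(\<Sum>q\<in>T \<times> T. \<Sum>x\<in>G. indic B x * indic B (x + (snd q - fst q)))
      = (\<Sum>q\<in>T \<times> T. \<Sum>x\<in>G. indic B (x + fst q) * indic B (x + snd q))"
  \<comment> \<open>Shifting x by the first coordinate turns the difference t - s into two separate
    shifts, so that the double sum becomes a square.\<close>
  proof (rule sum.cong[OF refl])
    fix q
    have "periodic (\<lambda>x. indic B x * indic B (x + (snd q - fst q)))"
      using B by (intro periodic_comp2[of _ _ "(*)"] periodic_shift periodic_indic)
    from sum_shift[OF this, of "fst q"]
    show "(\<Sum>x\<in>G. indic B x * indic B (x + (snd q - fst q)))
        = (\<Sum>x\<in>G. indic B (x + fst q) * indic B (x + snd q))"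
      by (simp add: algebra_simps)
  qed
  also have "\<dots> = (\<Sum>x\<in>G. (w x)\<^sup>2)"
  proof -
    have "(w x)\<^sup>2 = (\<Sum>q\<in>T \<times> T. indic B (x + fst q) * indic B (x + snd q))" for x
      unfolding w_def power2_eq_square sum_product sum.cartesian_product case_prod_beta ..
    then show ?thesis by (subst sum.swap) simp
  qed
  finally have eq: "(\<Sum>x\<in>G. indic B x * smooth T (indic B) x) = (\<Sum>x\<in>G. (w x)\<^sup>2) / (real (card T))\<^sup>2" .
  have "(\<Sum>x\<in>G. w x)\<^sup>2 \<le> real p * (\<Sum>x\<in>G. (w x)\<^sup>2)"
  proof -
    define \<mu> where "\<mu> = (\<Sum>x\<in>G. w x) / real p"
    \<comment> \<open>Cauchy-Schwarz in the form of a nonnegative variance.\<close>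
    have "0 \<le> (\<Sum>x\<in>G. (w x - \<mu>)\<^sup>2)" by (intro sum_nonneg) auto
    also have "\<dots> = (\<Sum>x\<in>G. (w x)\<^sup>2) - 2 * \<mu> * (\<Sum>x\<in>G. w x) + real p * \<mu>\<^sup>2"
      by (simp add: power2_diff sum.distrib sum_subtractf sum_distrib_left algebra_simps)
    also have "\<dots> = (\<Sum>x\<in>G. (w x)\<^sup>2) - (\<Sum>x\<in>G. w x)\<^sup>2 / real p"
      by (simp add: \<mu>_def power2_eq_square field_simps)
    finally show ?thesis by (simp add: field_simps)
  qed
  then have "(real (card T))\<^sup>2 * (card_mod B)\<^sup>2 \<le> real p * (\<Sum>x\<in>G. (w x)\<^sup>2)"
    unfolding w by (simp add: power_mult_distrib)
  then show ?thesis unfolding eq using cT by (simp add: field_simps)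
qed

text \<open>The correlation bound is applied to the exceptional set L itself: the smoothing of L is
  dominated by that of A, hence by u on L, so |L|^2 <= p u |L|.\<close>

lemma card_mod_low_smooth:
  assumes T: "finite T" "T \<noteq> {}" and A: "periodic_set A" and u: "0 \<le> u"
  shows "card_mod {x \<in> A. smooth T (indic A) x \<le> u} \<le> u * real p"
proof -
  define L where "L = {x \<in> A. smooth T (indic A) x \<le> u}"
  have L: "periodic_set L" using A smooth_periodic[OF periodic_indic[OF A], of T]
    unfolding L_def periodic_set_def periodic_def by simp
  have mono: "smooth T (indic L) x \<le> smooth T (indic A) x" for x
    unfolding smooth_def by (intro divide_right_mono sum_mono) (auto simp: indic_def L_def)
  have "(card_mod L)\<^sup>2 \<le> real p * (\<Sum>x\<in>G. indic L x * smooth T (indic L) x)"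
    by (rule smooth_correlation[OF T L])
  also have "\<dots> \<le> real p * (\<Sum>x\<in>G. indic L x * u)"
  proof (rule mult_left_mono[OF sum_mono])
    fix x show "indic L x * smooth T (indic L) x \<le> indic L x * u"
      using mono[of x] by (cases "x \<in> L") (auto simp: indic_def L_def)
  qed auto
  also have "\<dots> = card_mod L * (u * real p)" by (simp add: card_mod_def sum_distrib_right[symmetric])
  finally have "card_mod L * card_mod L \<le> card_mod L * (u * real p)" by (simp add: power2_eq_square)
  then show ?thesis unfolding L_def[symmetric]
    using u card_mod_nonneg[of L] by (cases "card_mod L = 0") auto
qed

text \<open>This bounds the total amount by which the saturated function 1 - (1 - f)^m stays below 1
  on A. It is uniform in T.\<close>

lemma sum_unsaturated_le:
  assumes T: "finite T" "T \<noteq> {}" and A: "periodic_set A" and m: "0 < m"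
  shows "(\<Sum>x\<in>G. indic A x * (1 - smooth T (indic A) x) ^ m) \<le> 4 * real p / real m"
proof -
  define f where "f = smooth T (indic A)"
  have f: "0 \<le> f x" "f x \<le> 1" for x
    unfolding f_def using T by (auto intro!: smooth_nonneg smooth_le)
  have "(\<Sum>x\<in>G. indic A x * (1 - f x) ^ m) \<le> 0 + 2 * (2 * real p / real m)"
  proof (rule sum_le_of_level_sets)
    fix v :: real assume v: "0 < v" "v \<le> 1"
    have "{x \<in> G. v \<le> indic A x * (1 - f x) ^ m} \<subseteq> {x \<in> A. f x \<le> 2 / (real m * sqrt v)} \<inter> G"
    proof safe
      fix x assume x: "v \<le> indic A x * (1 - f x) ^ m"
      then show "x \<in> A" using v by (auto simp: indic_def of_bool_def split: if_splits)
      then have "v \<le> (1 - f x) ^ m" using x by (simp add: indic_def)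
      also have "\<dots> \<le> exp (- f x) ^ m"
        using f[of x] exp_ge_add_one_self[of "- f x"] by (intro power_mono) auto
      also have "\<dots> = exp (- (real m * f x))" by (simp flip: exp_of_nat_mult)
      finally have ve: "v \<le> exp (- (real m * f x))" .
      \<comment> \<open>Instead of taking a logarithm of v <= exp (- m f), the cruder y <= exp y
        with y = m f / 2 is used. It gives a bound in 1 / sqrt v, the integrable shape that
        \<open>sum_le_of_level_sets\<close> expects.\<close>
      define e where "e = exp (real m * f x / 2)"
      have e: "e > 0" "exp (- (real m * f x)) = 1 / e\<^sup>2"
        by (simp_all add: e_def exp_minus power2_eq_square inverse_eq_divide flip: exp_add)
      have "sqrt v \<le> sqrt (1 / e\<^sup>2)" using ve e by simp
      then have "sqrt v \<le> 1 / e" using e(1) by (simp add: real_sqrt_divide)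
      then have "sqrt v * e \<le> 1" using e(1) by (simp add: field_simps)
      moreover have "real m * f x / 2 \<le> e"
        unfolding e_def using exp_ge_add_one_self[of "real m * f x / 2"] by linarith
      then have "sqrt v * (real m * f x / 2) \<le> sqrt v * e"
        using v by (intro mult_left_mono) auto
      ultimately have "sqrt v * (real m * f x / 2) \<le> 1" by linarith
      then show "f x \<le> 2 / (real m * sqrt v)" using m v by (simp add: field_simps)
    qed
    then have "real (card {x \<in> G. v \<le> indic A x * (1 - f x) ^ m})
        \<le> card_mod {x \<in> A. f x \<le> 2 / (real m * sqrt v)}"
      unfolding card_mod_eq_card by (intro of_nat_mono card_mono) auto
    also have "\<dots> \<le> 2 / (real m * sqrt v) * real p"
      unfolding f_def using v by (intro card_mod_low_smooth T A) auto
    finally show "real (card {x \<in> G. v \<le> indic A x * (1 - f x) ^ m})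
        \<le> 0 + 2 * real p / real m / sqrt v" by simp
  next
    fix x show "0 \<le> indic A x * (1 - f x) ^ m" using f[of x] by simp
    show "indic A x * (1 - f x) ^ m \<le> 1"
      using f[of x] by (intro mult_le_one power_le_one) auto
  qed auto
  then show ?thesis by (simp add: f_def)
qed

text \<open>Starting from f z < M, two good shifts, each costing a factor 4, reach at most 16 M. An
  average of at least 17 M thus needs a contribution M from pairs with a bad shift, where f is at
  most \<Phi>. Every shift is bad for at most H positions, so such z are few by Markov's
  inequality.\<close>

lemma card_mod_transfer_smooth:
  assumes T: "finite T" "T \<noteq> {}" and f: "periodic f" "\<And>z. 0 \<le> f z" "\<And>z. f z \<le> \<Phi>" and M: "0 < M"
    and ap: "\<And>s t. s \<in> T \<Longrightarrow> t \<in> T \<Longrightarrow> card_mod {z. f (z - s + t) > 4 * max (f z) M} \<le> H"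
  shows "card_mod {z. 17 * M \<le> smooth T (smooth T f) z} \<le> card_mod {z. M \<le> f z} + 2 * H * \<Phi> / M"
proof -
  define c where "c = (real (card T))\<^sup>2"
  have c: "c > 0" using T by (simp add: c_def card_gt_0_iff)
  have cTT: "real (card (T \<times> T)) = c" by (simp add: c_def power2_eq_square card_cartesian_product)
  define d where "d q = snd q - fst q" for q :: "int \<times> int"
  define bad where "bad q = indic {z. f (z + d q) > 4 * max (f z) M}" for q
  have badH: "(\<Sum>z\<in>G. bad q z) \<le> H" if "q \<in> T \<times> T" for q
    using ap[of "fst q" "snd q"] that by (auto simp: bad_def card_mod_def d_def algebra_simps)
  have badper: "periodic (bad q)" for q
    unfolding bad_def using periodic_mod[OF f(1)] periodic_mod[OF periodic_shift[OF f(1)]]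
    by (intro periodic_indic) (simp add: periodic_set_def periodic_def)
  have \<Phi>: "\<Phi> \<ge> 0" using f(2,3)[of 0] by linarith
  have sm: "smooth T h x = (\<Sum>q\<in>T \<times> T. h (x + d q)) / c" for h x
    by (simp add: smooth_def c_def d_def case_prod_beta)
  define S where "S = {z. 17 * M \<le> smooth T (smooth T f) z \<and> f z < M}"
  define Av where "Av z = (\<Sum>q\<in>T \<times> T. \<Sum>q'\<in>T \<times> T. \<Phi> * (bad q z + bad q' (z + d q))) / c\<^sup>2" for z
  have pt: "M * indic S z \<le> Av z" for z
  proof (cases "z \<in> S")
    case False
    then show ?thesis using \<Phi> unfolding Av_def bad_def
      by (auto simp: indic_def intro!: divide_nonneg_nonneg sum_nonneg)
  next
    case True
    have "smooth T (smooth T f) z = (\<Sum>q\<in>T \<times> T. \<Sum>q'\<in>T \<times> T. f (z + d q + d q')) / c\<^sup>2"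
      by (simp add: sm power2_eq_square flip: sum_divide_distrib)
    also have "\<dots> \<le> (\<Sum>q\<in>T \<times> T. \<Sum>q'\<in>T \<times> T. 16 * M + \<Phi> * (bad q z + bad q' (z + d q))) / c\<^sup>2"
    proof (intro divide_right_mono sum_mono)
      fix q q'
      show "f (z + d q + d q') \<le> 16 * M + \<Phi> * (bad q z + bad q' (z + d q))"
      proof (cases "bad q z = 0 \<and> bad q' (z + d q) = 0")
        case True
        then have "f (z + d q) \<le> 4 * max (f z) M" "f (z + d q + d q') \<le> 4 * max (f (z + d q)) M"
          by (auto simp: bad_def indic_def)
        then have "f (z + d q + d q') \<le> 16 * M" using \<open>z \<in> S\<close> M unfolding S_def by auto
        then show ?thesis using True by simp
      next
        case False
        then have "1 \<le> bad q z + bad q' (z + d q)" by (auto simp: bad_def indic_def)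
        then have "\<Phi> * 1 \<le> \<Phi> * (bad q z + bad q' (z + d q))" using \<Phi> by (intro mult_left_mono)
        then show ?thesis using f(3)[of "z + d q + d q'"] M by linarith
      qed
    qed auto
    also have "\<dots> = 16 * M + Av z"
      unfolding Av_def sum.distrib using c
      by (simp add: cTT add_divide_distrib power2_eq_square flip: of_nat_mult card_cartesian_product)
    finally show ?thesis using True by (simp add: S_def indic_def)
  qed
  have "M * card_mod S = (\<Sum>z\<in>G. M * indic S z)" by (simp add: card_mod_def sum_distrib_left)
  also have "\<dots> \<le> (\<Sum>z\<in>G. Av z)" by (intro sum_mono pt)
  also have "\<dots> = (\<Sum>q\<in>T \<times> T. \<Sum>q'\<in>T \<times> T. \<Sum>z\<in>G. \<Phi> * (bad q z + bad q' (z + d q))) / c\<^sup>2"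
    unfolding Av_def sum_divide_distrib[symmetric]
    by (subst sum.swap, subst (2) sum.swap) simp
  also have "\<dots> = (\<Sum>q\<in>T \<times> T. \<Sum>q'\<in>T \<times> T. \<Phi> * ((\<Sum>z\<in>G. bad q z) + (\<Sum>z\<in>G. bad q' z))) / c\<^sup>2"
    by (simp add: sum_shift[OF badper] sum.distrib flip: sum_distrib_left)
  also have "\<dots> \<le> (\<Sum>q\<in>T \<times> T. \<Sum>q'\<in>T \<times> T. \<Phi> * (H + H)) / c\<^sup>2"
    using \<Phi> by (intro divide_right_mono sum_mono mult_left_mono add_mono badH) auto
  also have "\<dots> = 2 * H * \<Phi>"
    using c by (simp only: sum_constant cTT) (simp add: power2_eq_square)
  finally have S: "card_mod S \<le> 2 * H * \<Phi> / M" using M by (simp add: field_simps)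
  have "card_mod {z. 17 * M \<le> smooth T (smooth T f) z} \<le> card_mod ({z. M \<le> f z} \<union> S)"
    by (rule card_mod_mono) (auto simp: S_def)
  also have "\<dots> \<le> card_mod {z. M \<le> f z} + card_mod S"
    using card_mod_Un_Int[of "{z. M \<le> f z}" S] card_mod_nonneg[of "{z. M \<le> f z} \<inter> S"] by linarith
  finally show ?thesis using S by linarith
qed

end

section \<open>Popular sums of level sets\<close>

context prime_modulus begin

lemma conv_ge_card_mod: 
  assumes "periodic_set Y" shows "card_mod X + card_mod Y - real p \<le> conv (indic X) (indic Y) z"
proof -
  have "card_mod X + card_mod Y - real p = (\<Sum>x\<in>G. indic X x + indic Y (z - x) - 1)"
    using sum_reflect[OF periodic_indic[OF assms], of z] by (simp add: card_mod_def sum.distrib sum_subtractf)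
  also have "\<dots> \<le> conv (indic X) (indic Y) z"
    unfolding conv_def by (intro sum_mono) (auto simp: indic_def)
  finally show ?thesis .
qed

text \<open>Pollard's theorem with t the ceiling of W: popular sums count at most t each, all others
  together at most W^2, and division by t leaves N + W. Restoring t costs at most 2 W more. The
  minimum with p disappears because for W <= p a total size above p + W would give every z at least
  W >= W^2/p representations, against \<open>N \<noteq> real p\<close>.\<close>

lemma card_mod_popular_sums:
  assumes X: "periodic_set X" and Y: "periodic_set Y" and W: "1 \<le> W" "W \<le> card_mod X" "W \<le> card_mod Y"
    and N: "N = card_mod {z. W\<^sup>2 / real p \<le> conv (indic X) (indic Y) z}" "N \<noteq> real p"
  shows "card_mod X + card_mod Y \<le> N + 3 * W"
proof -
  define t where "t = nat \<lceil>W\<rceil>"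
  have t: "W \<le> real t" "real t < W + 1" "1 \<le> real t" using W by (auto simp: t_def) linarith+
  have tle: "real t \<le> card_mod X" "real t \<le> card_mod Y"
    using W unfolding t_def card_mod_eq_card of_nat_le_iff nat_ceiling_le_eq by simp_all
  let ?P = "{z. W\<^sup>2 / real p \<le> conv (indic X) (indic Y) z}"
  have "real t * min (real p) (card_mod X + card_mod Y - real t)
      \<le> (\<Sum>z\<in>G. min (real t) (conv (indic X) (indic Y) z))"
    by (intro pollard X Y tle)
  also have "\<dots> \<le> (\<Sum>z\<in>G. real t * indic ?P z + W\<^sup>2 / real p)"
  proof (rule sum_mono)
    fix z show "min (real t) (conv (indic X) (indic Y) z) \<le> real t * indic ?P z + W\<^sup>2 / real p"
    proof (cases "z \<in> ?P")
      case True
      then show ?thesis by (simp add: indic_def add_increasing2)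
    qed (simp add: indic_def)
  qed
  also have "\<dots> = real t * N + W\<^sup>2"
    by (simp add: sum.distrib N(1) card_mod_def sum_distrib_left)
  also have "\<dots> \<le> real t * (N + W)"
    using t W by (simp add: power2_eq_square algebra_simps mult_right_mono)
  finally have main: "min (real p) (card_mod X + card_mod Y - real t) \<le> N + W"
    using t by (subst (asm) mult_le_cancel_left_pos) auto
  show ?thesis
  proof (cases "card_mod X + card_mod Y - real t \<le> real p")
    case True
    then show ?thesis using main t W by linarith
  next
    case False
    then have pN: "real p \<le> N + W" using main by simp
    consider "card_mod X + card_mod Y \<le> real p + W" | "real p < W" | "card_mod X + card_mod Y > real p + W" "W \<le> real p"
      by linarith
    then show ?thesis
    proof cases
      case 2
      then show ?thesis using card_mod_le_p[of X] card_mod_le_p[of Y] pN W by linarith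
    next
      case 3
      have "W * W \<le> W * real p" using 3 W by (intro mult_left_mono) auto
      then have "W\<^sup>2 / real p \<le> W" by (simp add: power2_eq_square field_simps)
      then have "z \<in> ?P" for z using conv_ge_card_mod[OF Y, of X z] 3 by simp
      then have "?P = UNIV" by blast
      then have "N = real p" unfolding N(1) by (simp add: card_mod_eq_card)
      then show ?thesis using N(2) by blast
    qed (use pN W in linarith)
  qed
qed

lemma periodic_set_ge: "periodic f \<Longrightarrow> periodic_set {x. c \<le> f x}"
  unfolding periodic_set_def periodic_def by simp

text \<open>Pollard's theorem needs both level sets to be large; when one is small, this
  first-moment bound controls the other. The convolution of the indicator of X with g has total |X|
  \<alpha> p. At popular z it is at most \<alpha> p, the mass of g; elsewhere it is at most m/u
  times the threshold, since f >= u/m on X.\<close>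

lemma card_mod_level_single:
  assumes f: "periodic f" "periodic g" "\<And>x. 0 \<le> f x" "\<And>x. 0 \<le> g x"
    and sg: "(\<Sum>x\<in>G. g x) = \<alpha> * real p" and \<alpha>: "0 < \<alpha>"
    and m: "0 < m" "1 \<le> real m * \<alpha>" and \<delta>: "0 < \<delta>" and u: "0 < u" "u \<le> 1"
  shows "card_mod {x. u / real m \<le> f x}
    \<le> card_mod {z. \<delta>\<^sup>2 * real p / (real m)\<^sup>2 \<le> conv f g z} + \<delta> * real p / sqrt u"
proof (cases "\<delta>\<^sup>2 \<le> u")
  case False
  \<comment> \<open>For such small u the error term alone exceeds p.\<close>
  then have "sqrt u < \<delta>" using \<delta> real_sqrt_less_mono[of u "\<delta>\<^sup>2"] by simp
  then have "real p \<le> \<delta> * real p / sqrt u" using u by (simp add: field_simps)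
  then show ?thesis using card_mod_le_p[of "{x. u / real m \<le> f x}"]
      card_mod_nonneg[of "{z. \<delta>\<^sup>2 * real p / (real m)\<^sup>2 \<le> conv f g z}"] by linarith
next
  case True
  define X where "X = {x. u / real m \<le> f x}"
  define S where "S = {z. \<delta>\<^sup>2 * real p / (real m)\<^sup>2 \<le> conv f g z}"
  have "card_mod X * (\<alpha> * real p) = (\<Sum>z\<in>G. conv (indic X) g z)"
    by (simp add: sum_conv[OF f(2)] card_mod_def sg)
  also have "\<dots> \<le> (\<Sum>z\<in>G. \<alpha> * real p * indic S z + real m / u * (\<delta>\<^sup>2 * real p / (real m)\<^sup>2))"
  proof (rule sum_mono)
    fix z
    show "conv (indic X) g z \<le> \<alpha> * real p * indic S z + real m / u * (\<delta>\<^sup>2 * real p / (real m)\<^sup>2)"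
    proof (cases "z \<in> S")
      case True
      have "conv (indic X) g z \<le> \<alpha> * real p"
        using conv_le_sum_right[OF f(2) _ f(4), of "indic X" z] sg by simp
      then show ?thesis using True u by (simp add: indic_def add_increasing2)
    next
      case False
      have "u / real m * conv (indic X) g z = (\<Sum>x\<in>G. (u / real m * indic X x) * g (z - x))"
        unfolding conv_def by (simp add: sum_distrib_left mult.assoc)
      also have "\<dots> \<le> conv f g z"
        unfolding conv_def using f by (intro sum_mono mult_right_mono) (auto simp: X_def indic_def)
      also have "\<dots> \<le> \<delta>\<^sup>2 * real p / (real m)\<^sup>2" using False unfolding S_def by simp
      finally have "conv (indic X) g z \<le> real m / u * (\<delta>\<^sup>2 * real p / (real m)\<^sup>2)"
        using u m by (simp add: field_simps)
      then show ?thesis using \<alpha> indic_nonneg[of S z] by (simp add: add_increasing)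
    qed
  qed
  also have "\<dots> = \<alpha> * real p * card_mod S + real p * (\<delta>\<^sup>2 * real p / (real m * u))"
    using m u by (simp add: sum.distrib card_mod_def sum_distrib_left power2_eq_square mult_ac)
  also have "\<dots> \<le> \<alpha> * real p * card_mod S + real p * (\<alpha> * (\<delta>\<^sup>2 * real p / u))"
  proof (intro add_left_mono mult_left_mono)
    have "1 * (\<delta>\<^sup>2 * real p / (real m * u)) \<le> real m * \<alpha> * (\<delta>\<^sup>2 * real p / (real m * u))"
      using m u by (intro mult_right_mono) auto
    then show "\<delta>\<^sup>2 * real p / (real m * u) \<le> \<alpha> * (\<delta>\<^sup>2 * real p / u)" using m by simp
  qed auto
  also have "\<dots> = (card_mod S + \<delta>\<^sup>2 * real p / u) * (\<alpha> * real p)" by (simp add: algebra_simps)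
  finally have 1: "card_mod X \<le> card_mod S + \<delta>\<^sup>2 * real p / u"
    using \<alpha> by (subst (asm) mult_le_cancel_right_pos) auto
  define s where "s = sqrt u"
  have s: "0 < s" "u = s * s" using u by (simp_all add: s_def)
  have "\<delta> \<le> s" unfolding s_def using True \<delta> real_le_rsqrt by blast
  then have "\<delta>\<^sup>2 / u \<le> \<delta> / sqrt u"
    unfolding s_def[symmetric] using s \<delta> by (simp add: power2_eq_square field_simps)
  then have "\<delta>\<^sup>2 / u * real p \<le> \<delta> / sqrt u * real p" by (intro mult_right_mono) auto
  then show ?thesis using 1 unfolding X_def S_def by simp
qed

text \<open>The choice W = \<delta> p / sqrt (u v) makes the popularity threshold independent of the
  levels: W^2/p representations by the two level sets, weighted by u/m and v/m, contribute exactly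
  \<delta>^2 p / m^2 to the convolution of f and g.\<close>

lemma card_mod_level_pair:
  assumes f: "periodic f" "periodic g" "\<And>x. 0 \<le> f x" "\<And>x. 0 \<le> g x"
    and sg: "(\<Sum>x\<in>G. f x) = \<alpha> * real p" "(\<Sum>x\<in>G. g x) = \<alpha> * real p" and \<alpha>: "0 < \<alpha>"
    and m: "0 < m" "1 \<le> real m * \<alpha>" and \<delta>: "0 < \<delta>" "1 \<le> \<delta> * real p"
    and u: "0 < u" "u \<le> 1" and v: "0 < v" "v \<le> 1"
    and N: "N = card_mod {z. \<delta>\<^sup>2 * real p / (real m)\<^sup>2 \<le> conv f g z}" "N \<noteq> real p"
  shows "card_mod {x. u / real m \<le> f x} + card_mod {x. v / real m \<le> g x} \<le> N + 3 * \<delta> * real p / sqrt v / sqrt u"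
proof -
  define X Y where "X = {x. u / real m \<le> f x}" and "Y = {x. v / real m \<le> g x}"
  define W where "W = \<delta> * real p / sqrt v / sqrt u"
  have su: "0 < sqrt u" "sqrt u \<le> 1" "0 < sqrt v" "sqrt v \<le> 1" using u v by auto
  have W1: "\<delta> * real p / sqrt u \<le> W" "\<delta> * real p / sqrt v \<le> W"
    unfolding W_def using su \<delta> by (simp_all add: field_simps mult_left_le)
  have "1 * sqrt u \<le> \<delta> * real p" using su \<delta> by linarith
  then have "1 \<le> \<delta> * real p / sqrt u" using su by (subst pos_le_divide_eq) auto
  then have W2: "1 \<le> W" using W1 by linarith
  have X1: "card_mod X \<le> N + W"
    using card_mod_level_single[OF f sg(2) \<alpha> m \<delta>(1) u] W1 unfolding N(1) X_def by linarith
  have "conv g f = conv f g" by (rule ext) (rule conv_commute[OF f(2,1)])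
  then have Y1: "card_mod Y \<le> N + W"
    using card_mod_level_single[OF f(2,1,4,3) sg(1) \<alpha> m \<delta>(1) v] W1 unfolding N(1) Y_def by simp
  have "card_mod X + card_mod Y \<le> N + 3 * W"
  proof (cases "W \<le> card_mod X \<and> W \<le> card_mod Y")
    case False
    then show ?thesis using X1 Y1 W2 by linarith
  next
    case True
    define N' where "N' = card_mod {z. W\<^sup>2 / real p \<le> conv (indic X) (indic Y) z}"
    have "N' \<le> N"
      unfolding N'_def N(1)
    proof (rule card_mod_mono, safe)
      fix z assume z: "W\<^sup>2 / real p \<le> conv (indic X) (indic Y) z"
      have "W\<^sup>2 / real p = \<delta>\<^sup>2 * real p / (u * v)"
        unfolding W_def using u v by (simp add: power_divide power_mult_distrib) (simp add: power2_eq_square mult_ac)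
      then have "\<delta>\<^sup>2 * real p / (real m)\<^sup>2 = (u / real m) * (v / real m) * (W\<^sup>2 / real p)"
        using u v by (simp add: power2_eq_square)
      also have "\<dots> \<le> (u / real m) * (v / real m) * conv (indic X) (indic Y) z"
        using z u v by (intro mult_left_mono) auto
      also have "\<dots> = conv (\<lambda>x. u / real m * indic X x) (\<lambda>x. v / real m * indic Y x) z"
        unfolding conv_def sum_distrib_left by (simp add: mult_ac)
      also have "\<dots> \<le> conv f g z"
        using u v f by (intro conv_mono) (auto simp: X_def Y_def indic_def)
      finally show "\<delta>\<^sup>2 * real p / (real m)\<^sup>2 \<le> conv f g z" .
    qed
    moreover have "N' \<noteq> real p"
      using \<open>N' \<le> N\<close> N card_mod_le_p[of "{z. \<delta>\<^sup>2 * real p / (real m)\<^sup>2 \<le> conv f g z}"] by linarith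
    then have "card_mod X + card_mod Y \<le> N' + 3 * W"
      using True f unfolding X_def Y_def
      by (intro card_mod_popular_sums W2 periodic_set_ge) (auto simp: N'_def X_def Y_def)
    ultimately show ?thesis by linarith
  qed
  then show ?thesis unfolding X_def Y_def W_def by simp
qed

text \<open>A weighted form of Pollard's theorem: integrating the set version over all pairs of level sets.\<close>

lemma saturated_sum_le:
  assumes f: "periodic f" "periodic g" "\<And>x. 0 \<le> f x" "\<And>x. 0 \<le> g x" "\<And>x. f x \<le> 1" "\<And>x. g x \<le> 1"
    and sg: "(\<Sum>x\<in>G. f x) = \<alpha> * real p" "(\<Sum>x\<in>G. g x) = \<alpha> * real p" and \<alpha>: "0 < \<alpha>"
    and m: "0 < m" "1 \<le> real m * \<alpha>" and \<delta>: "0 < \<delta>" "1 \<le> \<delta> * real p"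
    and N: "N = card_mod {z. \<delta>\<^sup>2 * real p / (real m)\<^sup>2 \<le> conv f g z}" "N \<noteq> real p"
  shows "(\<Sum>x\<in>G. 1 - (1 - f x) ^ m) + (\<Sum>x\<in>G. 1 - (1 - g x) ^ m) \<le> N + 12 * \<delta> * real p"
proof -
  have sat: "0 \<le> 1 - (1 - h) ^ m" "1 - (1 - h) ^ m \<le> 1" "1 - (1 - h) ^ m \<le> real m * h"
    if "0 \<le> h" "h \<le> 1" for h :: real
    using that Bernoulli_inequality[of "- h" m] by (auto intro: power_le_one)
  \<comment> \<open>By Bernoulli's inequality the saturated function is at most m h, so its level
    sets lie in those of h at height w/m.\<close>
  have level: "real (card {x \<in> G. w \<le> 1 - (1 - h x) ^ m}) \<le> card_mod {x. w / real m \<le> h x}"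
    if "\<And>x. 0 \<le> h x" "\<And>x. h x \<le> 1" for h :: "int \<Rightarrow> real" and w
    unfolding card_mod_eq_card
  proof (intro of_nat_mono card_mono)
    show "{x \<in> G. w \<le> 1 - (1 - h x) ^ m} \<subseteq> {x. w / real m \<le> h x} \<inter> G"
    proof safe
      fix x assume "w \<le> 1 - (1 - h x) ^ m"
      then have "w \<le> real m * h x" using sat(3)[of "h x"] that by force
      then show "w / real m \<le> h x" using m by (simp add: field_simps)
    qed
  qed auto
  \<comment> \<open>The level v is frozen while u is integrated, and the level set of g belongs to
    the constant term. Each of the two integrations doubles the error: 3 becomes 6 here and 12 at
    the end.\<close>
  have 1: "(\<Sum>x\<in>G. 1 - (1 - f x) ^ m) \<le> (N - card_mod {x. v / real m \<le> g x}) + 2 * (3 * \<delta> * real p / sqrt v)"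
    if v: "0 < v" "v \<le> 1" for v
  proof (rule sum_le_of_level_sets)
    fix u :: real assume u: "0 < u" "u \<le> 1"
    show "real (card {x \<in> G. u \<le> 1 - (1 - f x) ^ m})
        \<le> N - card_mod {x. v / real m \<le> g x} + 3 * \<delta> * real p / sqrt v / sqrt u"
      using card_mod_level_pair[OF f(1-4) sg \<alpha> m \<delta> u v N] level[of f u] f by force
  qed (use sat f \<delta> v in auto)
  have "(\<Sum>x\<in>G. 1 - (1 - g x) ^ m) \<le> (N - (\<Sum>x\<in>G. 1 - (1 - f x) ^ m)) + 2 * (6 * \<delta> * real p)"
  proof (rule sum_le_of_level_sets)
    fix v :: real assume v: "0 < v" "v \<le> 1"
    show "real (card {x \<in> G. v \<le> 1 - (1 - g x) ^ m})
        \<le> N - (\<Sum>x\<in>G. 1 - (1 - f x) ^ m) + 6 * \<delta> * real p / sqrt v"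
      using 1[OF v] level[of g v] f by force
  qed (use sat f \<delta> in auto)
  then show ?thesis by simp
qed

end

section \<open>Kloosterman sums\<close>

context prime_modulus begin

section \<open>Units, inverses and additive characters modulo p\<close>

abbreviation Gs :: "int set" where "Gs \<equiv> {1..<int p}"

definition inv_mod :: "int \<Rightarrow> int" where "inv_mod x = inv\<^bsub>Fp p\<^esub> x"

lemma Gs_subset_G: "Gs \<subseteq> G" by auto

lemma Gs_iff: "x \<in> Gs \<longleftrightarrow> x \<in> G \<and> \<not> int p dvd x"
  using zdvd_not_zless[of x "int p"] by auto (metis dvd_0_right less_le zless_imp_add1_zle add_0)

lemma prime_int: "prime (int p)"
  using prime_p by simp

lemma inv_mod: assumes "x \<in> Gs" shows "inv_mod x \<in> Gs" "[x * inv_mod x = 1] (mod int p)"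
proof -
  interpret res: residues_prime p "Fp p"
    by unfold_locales (use prime_p in auto)
  have u: "x \<in> Units (Fp p)" using assms res.res_prime_units_eq by auto
  then have "inv\<^bsub>Fp p\<^esub> x \<in> Units (Fp p)" by simp
  then show "inv_mod x \<in> Gs" using res.res_prime_units_eq by (auto simp: inv_mod_def of_nat_diff)
  have "x \<otimes>\<^bsub>Fp p\<^esub> inv\<^bsub>Fp p\<^esub> x = \<one>\<^bsub>Fp p\<^esub>" using u by simp
  then show "[x * inv_mod x = 1] (mod int p)"
    using prime_gt_1_int[OF prime_int] by (simp add: inv_mod_def res.res_mult_eq res.res_one_eq cong_def)
qed

lemma inv_mod_unique:
  assumes "x \<in> Gs" "y \<in> G" "[x * y = 1] (mod int p)" shows "y = inv_mod x"
proof -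
  have "[y = y * (x * inv_mod x)] (mod int p)"
    using cong_mult[OF cong_refl cong_sym[OF inv_mod(2)[OF assms(1)]], of y] by simp
  also have "y * (x * inv_mod x) = (x * y) * inv_mod x" by simp
  also have "[(x * y) * inv_mod x = 1 * inv_mod x] (mod int p)" by (intro cong_mult cong_refl assms)
  finally have "[y = inv_mod x] (mod int p)" by simp
  then show ?thesis using assms(2) inv_mod(1)[OF assms(1)] by (simp add: cong_def)
qed

lemma inv_mod_iv: "x \<in> Gs \<Longrightarrow> inv_mod (inv_mod x) = x"
  using inv_mod_unique[of "inv_mod x" x] inv_mod[of x] by (auto simp: mult.commute)

lemma inv_mod_bij: "bij_betw inv_mod Gs Gs"
  by (rule bij_betw_byWitness[of _ inv_mod]) (use inv_mod inv_mod_iv in auto)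

definition chi :: "int \<Rightarrow> complex" where "chi x = cis (2 * pi * of_int x / real p)"

lemma chi_0 [simp]: "chi 0 = 1" by (simp add: chi_def)

lemma chi_add: "chi (x + y) = chi x * chi y"
  by (simp add: chi_def cis_mult add_divide_distrib algebra_simps)

lemma chi_cnj: "cnj (chi x) = chi (- x)" by (simp add: chi_def cis_cnj)

lemma norm_chi [simp]: "norm (chi x) = 1" by (simp add: chi_def)

lemma chi_eq_1_iff: "chi x = 1 \<longleftrightarrow> int p dvd x"
proof
  assume "int p dvd x"
  then obtain k where k: "x = int p * k" by blast
  have "2 * pi * real_of_int x / real p = 2 * pi * of_int k"
    using p_pos by (simp add: k del: p_pos)
  then have "chi x = cis (2 * pi * of_int k)" by (simp only: chi_def)
  also have "\<dots> = 1" by (rule cis_multiple_2pi) simp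
  finally show "chi x = 1" .
next
  assume "chi x = 1"
  then have "cos (2 * pi * of_int x / real p) = 1" by (simp add: chi_def complex_eq_iff)
  then obtain n :: int where n: "2 * pi * of_int x / real p = of_int n * 2 * pi"
    unfolding cos_one_2pi_int by blast
  then have "real_of_int x = real_of_int (n * int p)" by (simp add: field_simps)
  then have "x = n * int p" by (simp only: of_int_eq_iff)
  then show "int p dvd x" by simp
qed

lemma chi_cong: "[x = y] (mod int p) \<Longrightarrow> chi x = chi y"
proof -
  assume "[x = y] (mod int p)"
  then have "chi (x - y) = 1" by (simp add: chi_eq_1_iff cong_iff_dvd_diff)
  then show ?thesis using chi_add[of "x - y" y] by simp
qed

lemma periodic_chi: "periodic (\<lambda>x. chi (a * x))"
  unfolding periodic_def by (intro allI chi_cong) (simp add: cong_def mod_simps)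

lemma sum_chi: "(\<Sum>x\<in>G. chi (a * x)) = (if int p dvd a then of_nat p else 0)"
proof (cases "int p dvd a")
  case True
  then have "chi (a * x) = 1" for x by (simp add: chi_eq_1_iff)
  then show ?thesis using True by simp
next
  case False
  have "(\<Sum>x\<in>G. chi (a * x)) = (\<Sum>x\<in>G. chi (a * (x + 1)))"
    by (rule sum_shift[OF periodic_chi, symmetric])
  also have "\<dots> = chi a * (\<Sum>x\<in>G. chi (a * x))"
    by (simp add: distrib_left chi_add sum_distrib_left mult.commute)
  finally show ?thesis using False chi_eq_1_iff[of a] by simp
qed

lemma sum_chi': "(\<Sum>x\<in>G. chi (x * a)) = (if int p dvd a then of_nat p else 0)"
  using sum_chi[of a] by (simp add: mult.commute)

lemma sum_chi_Gs: "\<not> int p dvd a \<Longrightarrow> (\<Sum>x\<in>Gs. chi (a * x)) = -1"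
proof -
  assume a: "\<not> int p dvd a"
  have G: "G = insert 0 Gs" by auto
  have "0 = (\<Sum>x\<in>insert 0 Gs. chi (a * x))" unfolding G[symmetric] using a by (simp add: sum_chi)
  also have "\<dots> = 1 + (\<Sum>x\<in>Gs. chi (a * x))" by (subst sum.insert) auto
  finally show ?thesis by (simp add: add_eq_0_iff)
qed

section \<open>Kloosterman sums and their fourth moment\<close>

definition kloosterman :: "int \<Rightarrow> int \<Rightarrow> complex"
  where "kloosterman a b = (\<Sum>x\<in>Gs. chi (a * x + b * inv_mod x))"

text \<open>Orthogonality in both frequencies turns the second moment into a count of collisions.
  The index set is general so that pairs of units may be taken, which turns it into a fourth
  moment.\<close>

lemma sum_norm_sq_chi:
  assumes I: "finite I"
  shows "(\<Sum>a\<in>G. \<Sum>b\<in>G. (norm (\<Sum>i\<in>I. chi (a * u i + b * v i)))\<^sup>2)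
    = (real p)\<^sup>2 * real (card {(i, j) \<in> I \<times> I. int p dvd u i - u j \<and> int p dvd v i - v j})"
proof -
  have pt: "complex_of_real ((norm (\<Sum>i\<in>I. chi (a * u i + b * v i)))\<^sup>2)
      = (\<Sum>i\<in>I. \<Sum>j\<in>I. chi (a * (u i - u j)) * chi (b * (v i - v j)))" for a b
    unfolding complex_norm_square cnj_sum chi_cnj sum_product
    by (intro sum.cong refl) (simp add: algebra_simps flip: chi_add)
  have "complex_of_real (\<Sum>a\<in>G. \<Sum>b\<in>G. (norm (\<Sum>i\<in>I. chi (a * u i + b * v i)))\<^sup>2)
      = (\<Sum>a\<in>G. \<Sum>b\<in>G. \<Sum>i\<in>I. \<Sum>j\<in>I. chi (a * (u i - u j)) * chi (b * (v i - v j)))"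
    by (simp only: of_real_sum pt)
  also have "\<dots> = (\<Sum>i\<in>I. \<Sum>j\<in>I. \<Sum>a\<in>G. \<Sum>b\<in>G. chi (a * (u i - u j)) * chi (b * (v i - v j)))"
    by (simp only: sum.swap[of _ I G])
  also have "\<dots> = (\<Sum>i\<in>I. \<Sum>j\<in>I. if int p dvd u i - u j \<and> int p dvd v i - v j then (of_nat p)\<^sup>2 else 0)"
    by (intro sum.cong refl)
      (simp add: sum_chi' power2_eq_square flip: sum_distrib_left sum_distrib_right)
  also have "\<dots> = complex_of_real ((real p)\<^sup>2 * real (card {(i, j) \<in> I \<times> I. int p dvd u i - u j \<and> int p dvd v i - v j}))"
  proof -
    have "{(i, j) \<in> I \<times> I. int p dvd u i - u j \<and> int p dvd v i - v j}
        = Sigma I (\<lambda>i. {j \<in> I. int p dvd u i - u j \<and> int p dvd v i - v j})" by auto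
    then show ?thesis using I by (simp add: sum_distrib_left mult.commute flip: sum.inter_filter)
  qed
  finally show ?thesis by (simp only: of_real_eq_iff)
qed

text \<open>Clearing denominators gives (zw - xy)(x + y) = 0 modulo p. Either both sums vanish, or
  the two pairs share sum and product and agree up to order. Each of the three alternatives is a
  family with two free units.\<close>

lemma reciprocal_sums_eq:
  assumes G: "x \<in> Gs" "y \<in> Gs" "z \<in> Gs" "w \<in> Gs"
    and 1: "int p dvd (x + y) - (z + w)" and 2: "int p dvd (inv_mod x + inv_mod y) - (inv_mod z + inv_mod w)"
  shows "(z = x \<and> w = y) \<or> (z = y \<and> w = x) \<or> (y = int p - x \<and> w = int p - z)"
proof -
  have eqI: "a = b" if "a \<in> Gs" "b \<in> Gs" "int p dvd a - b" for a b
    using that by (metis Gs_subset_G atLeastLessThan_iff mod_eq_dvd_iff mod_pos_pos_trivial subsetD)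
  have u: "int p dvd a * inv_mod a - 1" if "a \<in> Gs" for a
    using inv_mod(2)[OF that] by (simp add: cong_iff_dvd_diff)
  \<comment> \<open>As \<open>inv_mod\<close> inverts only modulo p, this integer identity carries
    every defect \<open>a * inv_mod a - 1\<close>, a multiple of p, explicitly.\<close>
  have "z * w * (x + y) - x * y * (z + w)
      = x * y * z * w * ((inv_mod x + inv_mod y) - (inv_mod z + inv_mod w))
        - y * z * w * (x * inv_mod x - 1) - x * z * w * (y * inv_mod y - 1)
        + x * y * w * (z * inv_mod z - 1) + x * y * z * (w * inv_mod w - 1)"
    by (simp add: algebra_simps)
  then have 3: "int p dvd z * w * (x + y) - x * y * (z + w)"
    by (simp only:)
      (intro dvd_add dvd_diff dvd_mult[OF 2] dvd_mult[OF u[OF G(1)]] dvd_mult[OF u[OF G(2)]]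
        dvd_mult[OF u[OF G(3)]] dvd_mult[OF u[OF G(4)]])
  have "(z * w - x * y) * (x + y) = (z * w * (x + y) - x * y * (z + w)) - x * y * ((x + y) - (z + w))"
    by (simp add: algebra_simps)
  then have "int p dvd (z * w - x * y) * (x + y)"
    by (simp only:) (intro dvd_diff 3 dvd_mult[OF 1])
  then consider (sum0) "int p dvd x + y" | (prods) "int p dvd z * w - x * y"
    using prime_dvd_mult_iff[OF prime_int] by blast
  then show ?thesis
  proof cases
    case sum0
    have c: "b = int p - a" if "a \<in> Gs" "b \<in> Gs" "int p dvd a + b" for a b
    proof -
      have "int p dvd (a + b) - int p" by (intro dvd_diff that(3) dvd_refl)
      then have "int p dvd b - (int p - a)" by (simp add: algebra_simps)
      moreover have "int p - a \<in> Gs" using that by auto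
      ultimately show ?thesis using eqI that by blast
    qed
    have "int p dvd (x + y) - ((x + y) - (z + w))" by (intro dvd_diff sum0 1)
    then have "int p dvd z + w" by simp
    then show ?thesis using c sum0 G by blast
  next
    case prods
    have "(x - z) * (x - w) = (z * w - x * y) + x * ((x + y) - (z + w))"
      by (simp add: algebra_simps)
    then have "int p dvd (x - z) * (x - w)"
      by (simp only:) (intro dvd_add prods dvd_mult[OF 1])
    then consider (xz) "int p dvd x - z" | (xw) "int p dvd x - w"
      using prime_dvd_mult_iff[OF prime_int] by blast
    then show ?thesis
    proof cases
      case xz
      then have "x = z" using eqI G by blast
      then show ?thesis using 1 eqI[of y w] G by simp
    next
      case xw
      then have "x = w" using eqI G by blast
      then show ?thesis using 1 eqI[of y z] G by simp
    qed
  qed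
qed

lemma kloosterman_fourth_moment:
  "(\<Sum>a\<in>G. \<Sum>b\<in>G. norm (kloosterman a b) ^ 4) \<le> (real p)\<^sup>2 * (3 * (real (card Gs))\<^sup>2)"
proof -
  define I where "I = Gs \<times> Gs"
  define u v where "u i = fst i + snd i" and "v i = inv_mod (fst i) + inv_mod (snd i)" for i
  have "norm (kloosterman a b) ^ 4 = (norm (\<Sum>i\<in>I. chi (a * u i + b * v i)))\<^sup>2" for a b
  proof -
    have "kloosterman a b * kloosterman a b = (\<Sum>i\<in>I. chi (a * u i + b * v i))"
      unfolding kloosterman_def sum_product sum.cartesian_product I_def
      by (intro sum.cong refl) (auto simp: u_def v_def algebra_simps simp flip: chi_add)
    then have "(norm (\<Sum>i\<in>I. chi (a * u i + b * v i)))\<^sup>2 = (norm (kloosterman a b))\<^sup>2 ^ 2"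
      by (simp add: power2_eq_square flip: norm_mult)
    then show ?thesis by simp
  qed
  then have "(\<Sum>a\<in>G. \<Sum>b\<in>G. norm (kloosterman a b) ^ 4) = (real p)\<^sup>2 *
      real (card {(i, j) \<in> I \<times> I. int p dvd u i - u j \<and> int p dvd v i - v j})"
    by (simp add: sum_norm_sq_chi I_def)
  also have "\<dots> \<le> (real p)\<^sup>2 * (3 * (real (card Gs))\<^sup>2)"
  proof (rule mult_left_mono)
    define f1 f2 f3 where "f1 i = (i, i)" and "f2 i = (i, (snd i, fst i))"
      and "f3 i = ((fst i, int p - fst i), (snd i, int p - snd i))" for i :: "int \<times> int"
    have "{(i, j) \<in> I \<times> I. int p dvd u i - u j \<and> int p dvd v i - v j} \<subseteq> f1 ` I \<union> f2 ` I \<union> f3 ` I"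
    proof clarify
      fix x y z w assume xy: "(x, y) \<in> I" "(z, w) \<in> I"
        and d: "int p dvd u (x, y) - u (z, w)" "int p dvd v (x, y) - v (z, w)"
        and nf: "((x, y), (z, w)) \<notin> f3 ` I" "((x, y), (z, w)) \<notin> f2 ` I"
      have xz: "(x, z) \<in> I" using xy by (auto simp: I_def)
      have "(z = x \<and> w = y) \<or> (z = y \<and> w = x) \<or> (y = int p - x \<and> w = int p - z)"
        using xy d by (intro reciprocal_sums_eq) (auto simp: I_def u_def v_def)
      moreover have "\<not> (y = int p - x \<and> w = int p - z)"
      proof
        assume "y = int p - x \<and> w = int p - z"
        then have "((x, y), (z, w)) = f3 (x, z)" by (simp add: f3_def)
        then show False using nf xz by blast
      qed
      moreover have "\<not> (z = y \<and> w = x)"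
      proof
        assume "z = y \<and> w = x"
        then have "((x, y), (z, w)) = f2 (x, y)" by (simp add: f2_def)
        then show False using nf xy by blast
      qed
      ultimately have "((x, y), (z, w)) = f1 (x, y)" by (simp add: f1_def)
      then show "((x, y), (z, w)) \<in> f1 ` I" using xy by blast
    qed
    then have "card {(i, j) \<in> I \<times> I. int p dvd u i - u j \<and> int p dvd v i - v j}
        \<le> card (f1 ` I \<union> f2 ` I \<union> f3 ` I)" by (intro card_mono) (auto simp: I_def)
    also have "\<dots> \<le> card (f1 ` I) + card (f2 ` I) + card (f3 ` I)"
      using card_Un_le[of "f1 ` I \<union> f2 ` I" "f3 ` I"] card_Un_le[of "f1 ` I" "f2 ` I"] by linarith
    also have "\<dots> \<le> card I + card I + card I"
      by (intro add_mono card_image_le) (auto simp: I_def)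
    finally have "real (card {(i, j) \<in> I \<times> I. int p dvd u i - u j \<and> int p dvd v i - v j})
        \<le> real (3 * card I)" by (intro of_nat_mono) simp
    then show "real (card {(i, j) \<in> I \<times> I. int p dvd u i - u j \<and> int p dvd v i - v j})
        \<le> 3 * (real (card Gs))\<^sup>2"
      by (simp add: I_def card_cartesian_product power2_eq_square)
  qed auto
  finally show ?thesis .
qed

text \<open>Substitution of c x for x. It makes one value of the sum recur at many frequency pairs,
  which amplifies the fourth moment into a pointwise bound.\<close>

lemma kloosterman_scale:
  assumes c: "c \<in> Gs" shows "kloosterman (a * c mod int p) (b * inv_mod c mod int p) = kloosterman a b"
proof -
  have cm: "(c * x) mod int p \<in> Gs" if "x \<in> Gs" for x
    using that c prime_dvd_mult_iff[OF prime_int] by (simp add: Gs_iff dvd_mod_iff del: atLeastLessThan_iff) auto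
  have ivm: "inv_mod ((c * x) mod int p) = (inv_mod c * inv_mod x) mod int p" if x: "x \<in> Gs" for x
  proof (rule inv_mod_unique[symmetric, OF cm[OF x]])
    have "[(c * x) mod int p * ((inv_mod c * inv_mod x) mod int p) = (c * x) * (inv_mod c * inv_mod x)] (mod int p)"
      by (intro cong_mult) (simp_all add: cong_def)
    also have "(c * x) * (inv_mod c * inv_mod x) = (c * inv_mod c) * (x * inv_mod x)" by simp
    also have "[(c * inv_mod c) * (x * inv_mod x) = 1 * 1] (mod int p)" by (intro cong_mult inv_mod c x)
    finally show "[(c * x) mod int p * ((inv_mod c * inv_mod x) mod int p) = 1] (mod int p)" by simp
  qed auto
  have bij: "bij_betw (\<lambda>x. (c * x) mod int p) Gs Gs"
  proof (rule bij_betw_byWitness[of _ "\<lambda>x. (inv_mod c * x) mod int p"])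
    have cancel: "(d * ((e * x) mod int p)) mod int p = x" if "x \<in> Gs" "[d * e = 1] (mod int p)" for x d e
    proof -
      have "[(d * e) * x = 1 * x] (mod int p)" by (intro cong_mult cong_refl that)
      then show ?thesis using that(1) by (simp add: cong_def mod_simps mult.assoc)
    qed
    show "\<forall>x\<in>Gs. (inv_mod c * ((c * x) mod int p)) mod int p = x"
      using cancel inv_mod(2)[OF c] by (simp add: mult.commute)
    show "\<forall>x\<in>Gs. (c * ((inv_mod c * x) mod int p)) mod int p = x"
      using cancel inv_mod(2)[OF c] by blast
    show "(\<lambda>x. (c * x) mod int p) ` Gs \<subseteq> Gs" using cm by blast
    show "(\<lambda>x. (inv_mod c * x) mod int p) ` Gs \<subseteq> Gs"
    proof safe
      fix x assume x: "x \<in> Gs"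
      have "(inv_mod c * x) mod int p = inv_mod ((c * inv_mod x) mod int p)"
        using ivm[of "inv_mod x"] inv_mod[OF x] inv_mod_iv[OF x] by simp
      then show "(inv_mod c * x) mod int p \<in> Gs" using inv_mod(1) cm inv_mod(1)[OF x] by metis
    qed
  qed
  have "kloosterman a b = (\<Sum>x\<in>Gs. chi (a * ((c * x) mod int p) + b * inv_mod ((c * x) mod int p)))"
    unfolding kloosterman_def by (rule sum.reindex_bij_betw[OF bij, symmetric])
  also have "\<dots> = kloosterman (a * c mod int p) (b * inv_mod c mod int p)"
    unfolding kloosterman_def
  proof (intro sum.cong refl chi_cong)
    fix x assume x: "x \<in> Gs"
    have "[a * ((c * x) mod int p) + b * inv_mod ((c * x) mod int p) = a * (c * x) + b * (inv_mod c * inv_mod x)] (mod int p)"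
      unfolding ivm[OF x] by (intro cong_add cong_mult cong_refl) (simp_all add: cong_def)
    moreover have "[a * c mod int p * x + b * inv_mod c mod int p * inv_mod x = (a * c) * x + (b * inv_mod c) * inv_mod x] (mod int p)"
      by (intro cong_add cong_mult cong_refl) (simp_all add: cong_def)
    ultimately show "[a * ((c * x) mod int p) + b * inv_mod ((c * x) mod int p)
        = a * c mod int p * x + b * inv_mod c mod int p * inv_mod x] (mod int p)"
      by (simp add: cong_def mult.assoc)
  qed
  finally show ?thesis by simp
qed

text \<open>Kloosterman's argument: if a and b are both nonzero modulo p, the value recurs at p - 1
  distinct frequency pairs, so p - 1 times its fourth power is at most 3 p^2 (p - 1)^2. If exactly
  one of them vanishes, the sum is -1.\<close>

lemma kloosterman_bound:
  assumes ab: "\<not> (int p dvd a \<and> int p dvd b)"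
  shows "norm (kloosterman a b) ^ 4 \<le> 3 * real p ^ 3"
proof -
  have p3: "1 \<le> 3 * real p ^ 3" using p_pos one_le_power[of "real p" 3] by linarith
  consider "int p dvd b" "\<not> int p dvd a" | "int p dvd a" "\<not> int p dvd b"
    | "\<not> int p dvd a" "\<not> int p dvd b" using ab by blast
  then show ?thesis
  proof cases
    case 1
    then have "kloosterman a b = (\<Sum>x\<in>Gs. chi (a * x))"
      unfolding kloosterman_def by (intro sum.cong refl chi_cong) (auto simp: cong_iff_dvd_diff)
    then show ?thesis using p3 sum_chi_Gs[OF 1(2)] by simp
  next
    case 2
    then have "kloosterman a b = (\<Sum>x\<in>Gs. chi (b * inv_mod x))"
      unfolding kloosterman_def by (intro sum.cong refl chi_cong) (auto simp: cong_iff_dvd_diff)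
    also have "\<dots> = (\<Sum>x\<in>Gs. chi (b * x))" by (rule sum.reindex_bij_betw[OF inv_mod_bij])
    finally show ?thesis using p3 sum_chi_Gs[OF 2(2)] by simp
  next
    case 3
    define h where "h c = (a * c mod int p, b * inv_mod c mod int p)" for c
    have inj: "inj_on h Gs"
    proof (rule inj_onI)
      fix c c' assume c: "c \<in> Gs" "c' \<in> Gs" "h c = h c'"
      then have "int p dvd a * c - a * c'" by (simp add: h_def mod_eq_dvd_iff)
      then have "int p dvd a * (c - c')" by (simp add: right_diff_distrib)
      then have "int p dvd c - c'" using 3 prime_dvd_mult_iff[OF prime_int] by blast
      then have "c mod int p = c' mod int p" by (simp add: mod_eq_dvd_iff)
      then show "c = c'" using c by simp
    qed
    have cpos: "real (card Gs) > 0" using prime_gt_1_nat[OF prime_p] by simp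
    have "real (card Gs) * norm (kloosterman a b) ^ 4
        = (\<Sum>c\<in>Gs. norm (kloosterman (fst (h c)) (snd (h c))) ^ 4)"
      by (simp add: h_def kloosterman_scale del: card_atLeastLessThan_int)
    also have "\<dots> = (\<Sum>q\<in>h ` Gs. norm (kloosterman (fst q) (snd q)) ^ 4)"
      by (subst sum.reindex[OF inj]) simp
    also have "\<dots> \<le> (\<Sum>q\<in>G \<times> G. norm (kloosterman (fst q) (snd q)) ^ 4)"
      by (intro sum_mono2) (auto simp: h_def)
    also have "\<dots> = (\<Sum>a\<in>G. \<Sum>b\<in>G. norm (kloosterman a b) ^ 4)"
      by (simp add: sum.cartesian_product case_prod_beta)
    also have "\<dots> \<le> (real p)\<^sup>2 * (3 * (real (card Gs))\<^sup>2)" by (rule kloosterman_fourth_moment)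
    also have "\<dots> = real (card Gs) * (3 * (real p)\<^sup>2 * real (card Gs))"
      by (simp add: power2_eq_square)
    finally have "norm (kloosterman a b) ^ 4 \<le> 3 * (real p)\<^sup>2 * real (card Gs)"
      using cpos by (subst (asm) mult_le_cancel_left_pos) auto
    also have "\<dots> \<le> 3 * (real p)\<^sup>2 * real p"
      by (intro mult_left_mono) auto
    finally show ?thesis by (simp add: power2_eq_square power3_eq_cube)
  qed
qed

end

section \<open>Fourier \<open>\<ell>\<^sup>1\<close> norms\<close>

context prime_modulus begin

text \<open>An upper bound for the norm in the Wiener algebra of the residues. Asking for some
  expansion into characters, rather than naming the transform, lets the closure rules exhibit
  coefficients directly.\<close>

definition wiener :: "(int \<Rightarrow> real) \<Rightarrow> real \<Rightarrow> bool"
  where "wiener f K \<longleftrightarrow> (\<exists>c :: int \<Rightarrow> complex.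
    (\<forall>x. of_real (f x) = (\<Sum>r\<in>G. c r * chi (r * x))) \<and> (\<Sum>r\<in>G. norm (c r)) \<le> K)"

lemma wiener_const: "wiener (\<lambda>_. k) \<bar>k\<bar>"
  unfolding wiener_def
proof (intro exI conjI allI)
  let ?c = "\<lambda>r::int. if r = 0 then complex_of_real k else 0"
  show "of_real k = (\<Sum>r\<in>G. ?c r * chi (r * x))" for x
    by (simp add: if_distrib[of "\<lambda>y. y * _"] cong: if_cong)
  show "(\<Sum>r\<in>G. norm (?c r)) \<le> \<bar>k\<bar>"
    by (simp add: if_distrib[of norm] cong: if_cong)
qed

lemma wiener_diff: 
  assumes "wiener f K" "wiener g L" shows "wiener (\<lambda>x. f x - g x) (K + L)"
proof -
  obtain c d where c: "\<And>x. of_real (f x) = (\<Sum>r\<in>G. c r * chi (r * x))" "(\<Sum>r\<in>G. norm (c r)) \<le> K"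
    and d: "\<And>x. of_real (g x) = (\<Sum>r\<in>G. d r * chi (r * x))" "(\<Sum>r\<in>G. norm (d r)) \<le> L"
    using assms unfolding wiener_def by blast
  show ?thesis unfolding wiener_def
  proof (intro exI[of _ "\<lambda>r. c r - d r"] conjI allI)
    show "of_real (f x - g x) = (\<Sum>r\<in>G. (c r - d r) * chi (r * x))" for x
      by (simp add: c d left_diff_distrib sum_subtractf)
    have "(\<Sum>r\<in>G. norm (c r - d r)) \<le> (\<Sum>r\<in>G. norm (c r) + norm (d r))"
      by (intro sum_mono norm_triangle_ineq4)
    then show "(\<Sum>r\<in>G. norm (c r - d r)) \<le> K + L" using c d by (simp add: sum.distrib)
  qed
qed

text \<open>Multiplication convolves the coefficients, and l1 is submultiplicative under
  convolution.\<close>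

lemma wiener_mult:
  assumes "wiener f K" "wiener g L" shows "wiener (\<lambda>x. f x * g x) (K * L)"
proof -
  obtain c d where c: "\<And>x. of_real (f x) = (\<Sum>r\<in>G. c r * chi (r * x))" "(\<Sum>r\<in>G. norm (c r)) \<le> K"
    and d: "\<And>x. of_real (g x) = (\<Sum>r\<in>G. d r * chi (r * x))" "(\<Sum>r\<in>G. norm (d r)) \<le> L"
    using assms unfolding wiener_def by blast
  have nn: "0 \<le> (\<Sum>r\<in>G. norm (c r))" "0 \<le> (\<Sum>r\<in>G. norm (d r))" by (simp_all add: sum_nonneg)
  \<comment> \<open>The coefficients are extended periodically so that t - r may leave the
    period.\<close>
  define d' where "d' r = d (r mod int p)" for r
  have d': "periodic d'" by (simp add: d'_def periodic_def)
  have d'_eq: "d' r = d r" if "r \<in> G" for r using that by (simp add: d'_def)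
  show ?thesis unfolding wiener_def
  proof (intro exI[of _ "\<lambda>t. \<Sum>r\<in>G. c r * d' (t - r)"] conjI allI)
    fix x
    have "of_real (f x * g x) = (\<Sum>r\<in>G. c r * chi (r * x) * (\<Sum>s\<in>G. d s * chi (s * x)))"
      by (simp add: c d sum_distrib_right)
    also have "\<dots> = (\<Sum>r\<in>G. c r * chi (r * x) * (\<Sum>t\<in>G. d' (t - r) * chi ((t - r) * x)))"
    proof (rule sum.cong[OF refl])
      fix r
      have "periodic (\<lambda>s. d' s * chi (x * s))" by (intro periodic_comp2[of _ _ "(*)"] d' periodic_chi)
      from sum_diff[OF this, of r]
      have "(\<Sum>t\<in>G. d' (t - r) * chi ((t - r) * x)) = (\<Sum>s\<in>G. d' s * chi (s * x))"
        by (simp only: mult.commute[of x])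
      also have "\<dots> = (\<Sum>s\<in>G. d s * chi (s * x))" by (intro sum.cong refl) (simp only: d'_eq)
      finally show "c r * chi (r * x) * (\<Sum>s\<in>G. d s * chi (s * x))
          = c r * chi (r * x) * (\<Sum>t\<in>G. d' (t - r) * chi ((t - r) * x))" by (simp only:)
    qed
    also have "\<dots> = (\<Sum>r\<in>G. \<Sum>t\<in>G. c r * d' (t - r) * chi (t * x))"
    proof (rule sum.cong[OF refl])
      fix r
      have "chi (r * x) * chi ((t - r) * x) = chi (t * x)" for t
        by (simp add: left_diff_distrib flip: chi_add)
      then show "c r * chi (r * x) * (\<Sum>t\<in>G. d' (t - r) * chi ((t - r) * x))
          = (\<Sum>t\<in>G. c r * d' (t - r) * chi (t * x))"
        unfolding sum_distrib_left by (intro sum.cong refl) (metis mult.assoc mult.commute)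
    qed
    also have "\<dots> = (\<Sum>t\<in>G. (\<Sum>r\<in>G. c r * d' (t - r)) * chi (t * x))"
      by (subst sum.swap) (simp add: sum_distrib_right)
    finally show "of_real (f x * g x) = (\<Sum>t\<in>G. (\<Sum>r\<in>G. c r * d' (t - r)) * chi (t * x))" .
  next
    have "(\<Sum>t\<in>G. norm (\<Sum>r\<in>G. c r * d' (t - r))) \<le> (\<Sum>t\<in>G. \<Sum>r\<in>G. norm (c r) * norm (d' (t - r)))"
      by (intro sum_mono order_trans[OF norm_sum]) (simp add: norm_mult)
    also have "\<dots> = (\<Sum>r\<in>G. norm (c r) * (\<Sum>t\<in>G. norm (d' t)))"
      by (subst sum.swap) (simp add: sum_diff[OF periodic_comp[OF d', of norm]] flip: sum_distrib_left)
    also have "\<dots> = (\<Sum>r\<in>G. norm (c r)) * (\<Sum>t\<in>G. norm (d t))"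
    proof -
      have "(\<Sum>t\<in>G. norm (d' t)) = (\<Sum>t\<in>G. norm (d t))"
        by (intro sum.cong refl) (simp only: d'_eq)
      then show ?thesis by (simp add: sum_distrib_right)
    qed
    also have "\<dots> \<le> K * L" using c d nn by (intro mult_mono) auto
    finally show "(\<Sum>t\<in>G. norm (\<Sum>r\<in>G. c r * d' (t - r))) \<le> K * L" .
  qed
qed

lemma wiener_power: "wiener f K \<Longrightarrow> wiener (\<lambda>x. f x ^ n) (K ^ n)"
proof (induction n)
  case 0
  then show ?case using wiener_const[of 1] by simp
qed (use wiener_mult in auto)

lemma wiener_mono: "wiener f K \<Longrightarrow> K \<le> L \<Longrightarrow> wiener f L"
  unfolding wiener_def by force

lemma fourier_inversion:
  assumes "periodic f"
  shows "of_real (f x) = (\<Sum>r\<in>G. (\<Sum>a\<in>G. of_real (f a) * chi (- (r * a))) / of_nat p * chi (r * x))"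
proof -
  have "(\<Sum>r\<in>G. (\<Sum>a\<in>G. of_real (f a) * chi (- (r * a))) / of_nat p * chi (r * x))
      = (\<Sum>r\<in>G. \<Sum>a\<in>G. of_real (f a) * chi (r * (x - a)) / of_nat p)"
  proof -
    have "chi (- (r * a)) * chi (r * x) = chi (r * (x - a))" for r a
      by (simp add: right_diff_distrib flip: chi_add)
    then have "of_real (f a) * chi (- (r * a)) / of_nat p * chi (r * x)
        = of_real (f a) * chi (r * (x - a)) / of_nat p" for r a
      by (metis times_divide_eq_left mult.assoc)
    then show ?thesis unfolding sum_divide_distrib sum_distrib_right by (simp only:)
  qed
  also have "\<dots> = (\<Sum>a\<in>G. of_real (f a) * (\<Sum>r\<in>G. chi (r * (x - a))) / of_nat p)"
    by (subst sum.swap) (simp add: sum_distrib_left sum_divide_distrib)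
  also have "\<dots> = (\<Sum>a\<in>G. if a = x mod int p then of_real (f a) else 0)"
  proof (intro sum.cong refl)
    fix a assume "a \<in> G"
    then have "int p dvd x - a \<longleftrightarrow> a = x mod int p"
      by (metis atLeastLessThan_iff mod_eq_dvd_iff mod_pos_pos_trivial)
    then show "of_real (f a) * (\<Sum>r\<in>G. chi (r * (x - a))) / of_nat p
        = (if a = x mod int p then complex_of_real (f a) else 0)"
      by (simp add: sum_chi')
  qed
  also have "\<dots> = of_real (f x)" by (simp add: periodic_mod[OF assms])
  finally show ?thesis by simp
qed

text \<open>The coefficient at r is that of the indicator, at most 1 in modulus, times |sum of chi
  (r t) over t in T|^2 / |T|^2. By Parseval these squares add up to p |T| before the division.
  Smoothing by differences of T is what produces squares here, so the norm is just the inverse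
  density of T.\<close>

lemma wiener_smooth:
  assumes T: "T \<subseteq> G" "T \<noteq> {}" and A: "periodic_set A"
  shows "wiener (smooth T (indic A)) (real p / real (card T))"
proof -
  have fT: "finite T" using T(1) by (rule finite_subset) simp
  have cT: "real (card T) > 0" using T fT by (simp add: card_gt_0_iff)
  define a where "a r = (\<Sum>x\<in>G. of_real (indic A x) * chi (- (r * x))) / of_nat p" for r
  define D where "D r = (\<Sum>q\<in>T \<times> T. chi (r * (snd q - fst q)))" for r
  have a1: "norm (a r) \<le> 1" for r
  proof -
    have "norm (\<Sum>x\<in>G. of_real (indic A x) * chi (- (r * x))) \<le> (\<Sum>x\<in>G. 1)"
      by (intro order_trans[OF norm_sum] sum_mono) (simp add: norm_mult)
    then show ?thesis by (simp add: a_def norm_divide divide_le_eq)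
  qed
  have D: "D r = of_real ((norm (\<Sum>t\<in>T. chi (r * t)))\<^sup>2)" for r
    unfolding D_def complex_norm_square cnj_sum chi_cnj sum_product sum.cartesian_product
    by (subst product_swap[symmetric], subst sum.reindex)
      (auto intro!: sum.cong simp: algebra_simps case_prod_beta simp flip: chi_add)
  have "(\<Sum>r\<in>G. D r) = (\<Sum>q\<in>T \<times> T. if fst q = snd q then of_nat p else 0)"
    unfolding D_def
  proof (subst sum.swap, intro sum.cong refl)
    fix q assume q: "q \<in> T \<times> T"
    have "int p dvd snd q - fst q \<longleftrightarrow> fst q = snd q"
    proof
      assume "int p dvd snd q - fst q"
      then have "snd q mod int p = fst q mod int p" by (simp add: mod_eq_dvd_iff)
      moreover have "fst q \<in> G" "snd q \<in> G" using q T(1) by auto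
      ultimately show "fst q = snd q" by simp
    qed simp
    then show "(\<Sum>r\<in>G. chi (r * (snd q - fst q))) = (if fst q = snd q then of_nat p else 0)"
      by (simp add: sum_chi')
  qed
  also have "\<dots> = (\<Sum>s\<in>T. \<Sum>t\<in>T. if s = t then of_nat p else 0)"
    by (simp add: sum.cartesian_product case_prod_beta)
  also have "\<dots> = of_real (real p * real (card T))" using fT by (simp add: mult.commute)
  finally have "complex_of_real (\<Sum>r\<in>G. (norm (\<Sum>t\<in>T. chi (r * t)))\<^sup>2)
      = of_real (real p * real (card T))"
    unfolding D of_real_sum .
  then have sumD: "(\<Sum>r\<in>G. norm (D r)) = real p * real (card T)"
    unfolding D of_real_eq_iff by (simp add: norm_power)
  show ?thesis unfolding wiener_def
  proof (intro exI[of _ "\<lambda>r. a r * (D r / (of_nat (card T))\<^sup>2)"] conjI allI)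
    fix x
    have "complex_of_real (smooth T (indic A) x)
        = (\<Sum>q\<in>T \<times> T. of_real (indic A (x + (snd q - fst q)))) / (of_nat (card T))\<^sup>2"
      by (simp add: smooth_def case_prod_beta)
    also have "\<dots> = (\<Sum>q\<in>T \<times> T. \<Sum>r\<in>G. a r * chi (r * (x + (snd q - fst q)))) / (of_nat (card T))\<^sup>2"
      unfolding a_def by (subst fourier_inversion[OF periodic_indic[OF A]]) simp
    also have "\<dots> = (\<Sum>r\<in>G. a r * (D r / (of_nat (card T))\<^sup>2) * chi (r * x))"
      unfolding D_def
      by (subst sum.swap)
        (simp add: sum_divide_distrib sum_distrib_left sum_distrib_right distrib_left chi_add mult_ac)
    finally show "of_real (smooth T (indic A) x) = (\<Sum>r\<in>G. a r * (D r / (of_nat (card T))\<^sup>2) * chi (r * x))" .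
  next
    have "(\<Sum>r\<in>G. norm (a r * (D r / (of_nat (card T))\<^sup>2))) \<le> (\<Sum>r\<in>G. norm (D r) / (real (card T))\<^sup>2)"
    proof (rule sum_mono)
      fix r show "norm (a r * (D r / (of_nat (card T))\<^sup>2)) \<le> norm (D r) / (real (card T))\<^sup>2"
        using mult_right_mono[OF a1[of r], of "norm (D r) / (real (card T))\<^sup>2"]
        by (simp add: norm_mult norm_divide norm_power)
    qed
    also have "\<dots> = real p / real (card T)"
      using cT by (simp add: sumD power2_eq_square flip: sum_divide_distrib)
    finally show "(\<Sum>r\<in>G. norm (a r * (D r / (of_nat (card T))\<^sup>2))) \<le> real p / real (card T)" .
  qed
qed

text \<open>Expanding f and g turns the sum over units into a combination of Kloosterman sums.
  Frequency (0,0) gives the main term, with p - 1 estimated by p; every other one is at most 2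
  p^(3/4), where 2 rounds up the fourth root of 3.\<close>

lemma reciprocal_equidistribution:
  assumes f: "wiener f K" "\<And>x. 0 \<le> f x" and g: "wiener g L" "\<And>x. 0 \<le> g x"
  shows "(\<Sum>x\<in>Gs. f x * g (inv_mod x)) \<le> (\<Sum>x\<in>G. f x) * (\<Sum>x\<in>G. g x) / real p
    + K * L * (2 * real p powr (3/4))"
proof -
  obtain c d where c: "\<And>x. of_real (f x) = (\<Sum>r\<in>G. c r * chi (r * x))" "(\<Sum>r\<in>G. norm (c r)) \<le> K"
    and d: "\<And>x. of_real (g x) = (\<Sum>r\<in>G. d r * chi (r * x))" "(\<Sum>r\<in>G. norm (d r)) \<le> L"
    using f g unfolding wiener_def by blast
  define B where "B = 2 * real p powr (3/4)"
  have B: "norm (kloosterman r s) \<le> B" if "r \<in> G" "s \<in> G" "(r, s) \<noteq> (0, 0)" for r s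
  proof -
    have nd: "\<not> int p dvd x" if "x \<in> G" "x \<noteq> 0" for x
      using that zdvd_not_zless[of x "int p"] by auto
    have "norm (kloosterman r s) ^ 4 \<le> 3 * real p ^ 3"
      using nd that by (intro kloosterman_bound) auto
    also have "\<dots> \<le> 16 * real p ^ 3" by simp
    also have "16 * real p ^ 3 = B ^ 4"
    proof -
      have "(real p powr (3/4)) ^ 4 = real p powr (3/4 * 4)"
        by (simp add: powr_powr flip: powr_numeral)
      also have "\<dots> = real p ^ 3" by (simp flip: powr_numeral)
      finally show ?thesis by (simp add: B_def power_mult_distrib)
    qed
    finally show ?thesis by (subst (asm) power_mono_iff) (simp_all add: B_def)
  qed
  have mean: "(\<Sum>x\<in>G. complex_of_real (h x)) = e 0 * of_nat p"
    if "\<And>x. of_real (h x) = (\<Sum>r\<in>G. e r * chi (r * x))" for h e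
  proof -
    have "(\<Sum>x\<in>G. complex_of_real (h x)) = (\<Sum>r\<in>G. e r * (\<Sum>x\<in>G. chi (r * x)))"
      unfolding that by (subst sum.swap) (simp add: sum_distrib_left)
    also have "\<dots> = (\<Sum>r\<in>G. if r = 0 then e 0 * of_nat p else 0)"
      by (intro sum.cong refl) (use zdvd_not_zless in \<open>force simp: sum_chi\<close>)
    finally show ?thesis by simp
  qed
  have c0: "complex_of_real (\<Sum>x\<in>G. f x) = c 0 * of_nat p"
    and d0: "complex_of_real (\<Sum>x\<in>G. g x) = d 0 * of_nat p"
    unfolding of_real_sum by (rule mean[OF c(1)], rule mean[OF d(1)])
  have n0: "real p * (norm (c 0) * norm (d 0)) = (\<Sum>x\<in>G. f x) * (\<Sum>x\<in>G. g x) / real p"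
  proof -
    have "\<bar>\<Sum>x\<in>G. f x\<bar> = norm (c 0) * real p" "\<bar>\<Sum>x\<in>G. g x\<bar> = norm (d 0) * real p"
      using arg_cong[OF c0, of norm] arg_cong[OF d0, of norm] by (simp_all add: norm_mult del: of_real_sum)
    moreover have "0 \<le> (\<Sum>x\<in>G. f x)" "0 \<le> (\<Sum>x\<in>G. g x)" using f g by (auto intro: sum_nonneg)
    ultimately show ?thesis by simp
  qed
  have "complex_of_real (\<Sum>x\<in>Gs. f x * g (inv_mod x))
      = (\<Sum>x\<in>Gs. \<Sum>q\<in>G \<times> G. c (fst q) * d (snd q) * chi (fst q * x + snd q * inv_mod x))"
    by (simp add: c d sum_product sum.cartesian_product case_prod_beta chi_add mult_ac)
  also have "\<dots> = (\<Sum>q\<in>G \<times> G. c (fst q) * d (snd q) * kloosterman (fst q) (snd q))"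
    unfolding kloosterman_def by (subst sum.swap) (simp add: sum_distrib_left)
  finally have "\<bar>\<Sum>x\<in>Gs. f x * g (inv_mod x)\<bar>
      = norm (\<Sum>q\<in>G \<times> G. c (fst q) * d (snd q) * kloosterman (fst q) (snd q))"
    by (metis norm_of_real)
  also have "\<dots> \<le> (\<Sum>q\<in>G \<times> G. norm (c (fst q)) * norm (d (snd q)) * norm (kloosterman (fst q) (snd q)))"
    by (rule order_trans[OF norm_sum]) (simp add: norm_mult)
  also have "\<dots> \<le> (\<Sum>q\<in>G \<times> G. (if q = (0, 0) then real p * (norm (c 0) * norm (d 0)) else 0)
      + norm (c (fst q)) * norm (d (snd q)) * B)"
  proof (rule sum_mono)
    fix q assume q: "q \<in> G \<times> G"
    show "norm (c (fst q)) * norm (d (snd q)) * norm (kloosterman (fst q) (snd q))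
      \<le> (if q = (0, 0) then real p * (norm (c 0) * norm (d 0)) else 0)
        + norm (c (fst q)) * norm (d (snd q)) * B"
    proof (cases "q = (0, 0)")
      case True
      have "norm (kloosterman 0 0) \<le> real p"
        unfolding kloosterman_def by (rule order_trans[OF norm_sum]) simp
      then have "norm (c 0) * norm (d 0) * norm (kloosterman 0 0) \<le> norm (c 0) * norm (d 0) * real p"
        by (intro mult_left_mono) auto
      moreover have "0 \<le> norm (c 0) * norm (d 0) * B" by (simp add: B_def)
      ultimately show ?thesis using True by (simp add: mult_ac)
    next
      case False
      then show ?thesis using B[of "fst q" "snd q"] q by (auto intro!: mult_left_mono)
    qed
  qed
  also have "\<dots> = real p * (norm (c 0) * norm (d 0)) + (\<Sum>r\<in>G. norm (c r)) * (\<Sum>r\<in>G. norm (d r)) * B"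
    by (simp add: sum.distrib)
      (simp add: sum_product sum.cartesian_product case_prod_beta flip: sum_distrib_right)
  also have "\<dots> \<le> real p * (norm (c 0) * norm (d 0)) + K * L * B"
    using c d order_trans[OF sum_nonneg c(2)] by (intro add_left_mono mult_right_mono mult_mono)
      (auto simp: B_def sum_nonneg)
  finally show ?thesis using n0 by (simp add: B_def)
qed

end

section \<open>Combining the estimates\<close>

text \<open>A perturbed AM-GM inequality. For 9 \<delta> <= a the square of the left-hand side is at
  most 4 (a^2 - 9 a \<delta>); for larger \<delta> the left-hand side is negative.\<close>

lemma add_ge_of_mult_ge:
  fixes a \<delta> s t :: real
  assumes "0 \<le> s" "0 \<le> t" "0 \<le> \<delta>" and st: "a\<^sup>2 - 9 * a * \<delta> \<le> s * t"
  shows "2 * a - 18 * \<delta> \<le> s + t"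
proof (cases "9 * \<delta> \<le> a")
  case True
  have "9 * \<delta> * (36 * \<delta>) \<le> a * (36 * \<delta>)" using True assms by (intro mult_right_mono) auto
  then have "(2 * a - 18 * \<delta>)\<^sup>2 \<le> 4 * (a\<^sup>2 - 9 * a * \<delta>)"
    by (simp add: power2_eq_square algebra_simps)
  also have "\<dots> \<le> 4 * (s * t)" using st by simp
  also have "\<dots> \<le> (s + t)\<^sup>2"
    using zero_le_power2[of "s - t"] by (simp add: power2_eq_square algebra_simps)
  finally have "(2 * a - 18 * \<delta>)\<^sup>2 \<le> (s + t)\<^sup>2" .
  then show ?thesis by (rule power2_le_imp_le) (use assms in simp)
qed (use assms in linarith)

context prime_modulus begin

definition periodic_ext :: "int set \<Rightarrow> int set" where "periodic_ext S = {x. x mod int p \<in> S}"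

lemma periodic_set_ext: "periodic_set (periodic_ext S)" by (simp add: periodic_set_def periodic_def periodic_ext_def)

lemma periodic_ext_Int_G: "S \<subseteq> G \<Longrightarrow> periodic_ext S \<inter> G = S" by (auto simp: periodic_ext_def)

lemma indic_ext: "x \<in> G \<Longrightarrow> indic (periodic_ext S) x = of_bool (x \<in> S)"
  by (simp add: indic_def periodic_ext_def)

lemma card_mod_ext: "S \<subseteq> G \<Longrightarrow> card_mod (periodic_ext S) = real (card S)"
  by (simp add: card_mod_eq_card periodic_ext_Int_G)

text \<open>The parameters stay free, and the hypotheses record what is asked of each. The 68 is 17
  times 4: 17 from the transfer to smoothed functions, 4 from inserting m <= 2 / (sqrt \<alpha>
  \<delta>) into \<delta>^2 / m^2. The 31 collects 18 from AM-GM, 12 from the saturated sums and 1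
  from the transfer.\<close>

lemma card_mod_popular_reciprocal:
  assumes A: "A \<subseteq> Gs" "real (card A) = \<alpha> * real p" "0 < \<alpha>"
    and \<delta>: "0 < \<delta>" "\<alpha> * \<delta> ^ 4 = 68 * \<epsilon>" "\<delta> \<le> sqrt \<alpha>" "1 \<le> \<delta> * real p"
    and m: "1 / (sqrt \<alpha> * \<delta>) \<le> real m" "real m \<le> 2 / (sqrt \<alpha> * \<delta>)"
    and k: "0 < k" "16 * exp (- real k * \<epsilon> / (8 * \<alpha>)) * \<alpha> / \<epsilon> \<le> \<delta>"
    and K: "(1 + (1 + 2 / \<alpha> ^ k) ^ m)\<^sup>2 * (2 * real p powr (3/4)) \<le> \<delta>\<^sup>2 * real p"
  shows "card_mod {z. \<epsilon> * real p \<le> conv (indic (periodic_ext A)) (indic (periodic_ext (inv_mod ` A))) z}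
    \<ge> min (2 * sqrt \<alpha> * real p) (real p) - 31 * \<delta> * real p"
proof -
  define B where "B = inv_mod ` A"
  define f where "f = conv (indic (periodic_ext A)) (indic (periodic_ext B))"
  have AG: "A \<subseteq> G" using A by auto
  have BGs: "B \<subseteq> Gs" using A(1) inv_mod(1) by (auto simp only: B_def)
  then have BG: "B \<subseteq> G" by auto
  have inj: "inj_on inv_mod A" using inv_mod_bij A(1) by (meson bij_betw_imp_inj_on inj_on_subset)
  have cB: "card B = card A" unfolding B_def by (rule card_image[OF inj])
  have "0 < \<alpha> * \<delta> ^ 4" using \<delta>(1) A(3) by simp
  then have \<epsilon>: "0 < \<epsilon>" using \<delta>(2) by linarith
  have sa: "0 < sqrt \<alpha>" "sqrt \<alpha> * sqrt \<alpha> = \<alpha>" using A by auto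
  have "0 < 1 / (sqrt \<alpha> * \<delta>)" using sa \<delta>(1) by simp
  then have "0 < real m" using m(1) by linarith
  then have m0: "0 < m" by simp
  have im: "1 / real m \<le> sqrt \<alpha> * \<delta>" "sqrt \<alpha> * \<delta> / 2 \<le> 1 / real m"
  proof -
    have "1 / real m \<le> d \<and> d / 2 \<le> 1 / real m" if "0 < d" "1 / d \<le> real m" "real m \<le> 2 / d" for d
      using that m0 by (simp add: field_simps)
    from this[OF _ m] show "1 / real m \<le> sqrt \<alpha> * \<delta>" "sqrt \<alpha> * \<delta> / 2 \<le> 1 / real m"
      using sa \<delta>(1) by simp_all
  qed
  have m\<alpha>: "1 \<le> real m * \<alpha>"
  proof -
    have "sqrt \<alpha> * \<delta> \<le> \<alpha>" using mult_left_mono[OF \<delta>(3), of "sqrt \<alpha>"] sa by simp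
    then have "1 / real m \<le> \<alpha>" using im by linarith
    then show ?thesis using m0 by (simp add: field_simps)
  qed
  have "0 < \<alpha> * real p" using A(3) by simp
  then have n0: "0 < card A" using A(2) by linarith
  \<comment> \<open>The samples are drawn from the inverse set, which also has density \<alpha>, so
    T has density at least \<alpha>^k / 2.\<close>
  obtain T where T: "T \<subseteq> G" "real p * (real (card A) / real p) ^ k / 2 \<le> real (card T)"
    and ap: "\<And>s t. s \<in> T \<Longrightarrow> t \<in> T \<Longrightarrow>
      card_mod {z. conv (indic (periodic_ext B)) (indic (periodic_ext A)) (z - s + t) > 4 * max (conv (indic (periodic_ext B)) (indic (periodic_ext A)) z) (\<epsilon> * real p)}
        \<le> 8 * exp (- real k * (\<epsilon> * real p) / (8 * real (card A))) * real p"
  proof (rule almost_periods[where A = "periodic_ext A" and B = "periodic_ext B" and M = "\<epsilon> * real p" and n = "card A" and k = k])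
    show "card (periodic_ext B \<inter> G) = card A" using periodic_ext_Int_G[OF BG] cB by simp
    show "0 \<le> \<epsilon> * real p" using \<epsilon> by simp
  qed (use periodic_set_ext n0 k(1) in \<open>assumption | blast\<close>)+
  have cT: "real p * \<alpha> ^ k / 2 \<le> real (card T)" using T(2) A(2) by simp
  moreover have "0 < real p * \<alpha> ^ k / 2" using A(3) by simp
  ultimately have cT0: "0 < real (card T)" by linarith
  then have fT: "finite T" "T \<noteq> {}" by (auto simp: card_gt_0_iff)
  have Rc: "conv (indic (periodic_ext B)) (indic (periodic_ext A)) = f"
    unfolding f_def by (rule ext) (intro conv_commute periodic_indic periodic_set_ext)
  have fper: "periodic f" unfolding f_def by (intro conv_periodic periodic_indic periodic_set_ext)
  define f1 f2 where "f1 = smooth T (indic (periodic_ext A))" and "f2 = smooth T (indic (periodic_ext B))"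
  have f1: "periodic f1" "\<And>x. 0 \<le> f1 x" "\<And>x. f1 x \<le> 1" and f2: "periodic f2" "\<And>x. 0 \<le> f2 x" "\<And>x. f2 x \<le> 1"
    unfolding f1_def f2_def
    by (rule smooth_periodic periodic_indic periodic_set_ext smooth_nonneg smooth_le[OF fT] indic_nonneg indic_le_1)+
  have sum1: "(\<Sum>x\<in>G. f1 x) = \<alpha> * real p" and sum2: "(\<Sum>x\<in>G. f2 x) = \<alpha> * real p"
    unfolding f1_def f2_def sum_smooth[OF fT periodic_indic[OF periodic_set_ext]]
    using card_mod_ext[OF AG] card_mod_ext[OF BG] unfolding card_mod_def cB A(2) .
  have fle: "f z \<le> \<alpha> * real p" for z
  proof -
    have "f z \<le> card_mod (periodic_ext B)"
      unfolding f_def card_mod_def by (rule conv_le_sum_right) (rule periodic_indic periodic_set_ext indic_nonneg indic_le_1)+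
    then show ?thesis using card_mod_ext[OF BG] unfolding cB A(2) by simp
  qed
  define N where "N = card_mod {z. \<delta>\<^sup>2 * real p / (real m)\<^sup>2 \<le> conv f1 f2 z}"
  define P where "P = card_mod {z. \<epsilon> * real p \<le> f z}"
  have NP: "N \<le> P + \<delta> * real p"
  proof -
    have 17: "17 * (\<epsilon> * real p) \<le> \<delta>\<^sup>2 * real p / (real m)\<^sup>2"
    proof -
      have "17 * \<epsilon> = \<delta>\<^sup>2 * (sqrt \<alpha> * \<delta> / 2)\<^sup>2"
      proof -
        have "\<delta>\<^sup>2 * (s * \<delta> / 2)\<^sup>2 = (s * s) * \<delta> ^ 4 / 4" for s
          by (simp add: power2_eq_square eval_nat_numeral)
        from this[of "sqrt \<alpha>"] show ?thesis unfolding sa(2) \<delta>(2) by simp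
      qed
      also have "\<dots> \<le> \<delta>\<^sup>2 * (1 / real m)\<^sup>2"
        using im sa \<delta>(1) by (intro mult_left_mono power_mono) auto
      finally have "17 * \<epsilon> * real p \<le> \<delta>\<^sup>2 * (1 / real m)\<^sup>2 * real p" by (intro mult_right_mono) auto
      then show ?thesis by (simp add: power_divide mult_ac)
    qed
    have "N \<le> card_mod {z. 17 * (\<epsilon> * real p) \<le> smooth T (smooth T f) z}"
    proof -
      have "conv f1 f2 z = smooth T (smooth T f) z" for z
        unfolding f1_def f2_def f_def by (rule conv_smooth_smooth) (rule periodic_indic periodic_set_ext)+
      then show ?thesis
        unfolding N_def using 17 by (intro card_mod_mono Collect_mono) (metis order_trans)
    qed
    also have "\<dots> \<le> P + 2 * (8 * exp (- real k * (\<epsilon> * real p) / (8 * real (card A))) * real p)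
        * (\<alpha> * real p) / (\<epsilon> * real p)"
      unfolding P_def using ap \<epsilon> unfolding Rc
      by (intro card_mod_transfer_smooth fT fper fle) (auto simp: f_def conv_nonneg)
    also have "\<dots> = P + 16 * exp (- real k * \<epsilon> / (8 * \<alpha>)) * \<alpha> / \<epsilon> * real p"
    proof -
      have "- real k * (\<epsilon> * real p) / (8 * real (card A)) = - real k * \<epsilon> / (8 * \<alpha>)"
        unfolding A(2) using p_pos by (simp del: p_pos)
      then show ?thesis using p_pos by (simp del: p_pos)
    qed
    also have "\<dots> \<le> P + \<delta> * real p" using k by (intro add_left_mono mult_right_mono) auto
    finally show ?thesis .
  qed
  have "min (2 * sqrt \<alpha> * real p) (real p) - 30 * \<delta> * real p \<le> N"
  \<comment> \<open>If N = p the claim is immediate; the weighted Pollard bound covers the other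
    case.\<close>
  proof (cases "N = real p")
    case True
    moreover have "0 \<le> 30 * \<delta> * real p" using \<delta>(1) by simp
    ultimately show ?thesis by linarith
  next
    case False
    define g1 g2 where "g1 x = 1 - (1 - f1 x) ^ m" and "g2 x = 1 - (1 - f2 x) ^ m" for x
    have g: "0 \<le> g1 x" "g1 x \<le> 1" "0 \<le> g2 x" "g2 x \<le> 1" for x
      using f1 f2 by (auto simp: g1_def g2_def intro: power_le_one)
    define s1 s2 where "s1 = (\<Sum>x\<in>G. g1 x)" and "s2 = (\<Sum>x\<in>G. g2 x)"
    have s0: "0 \<le> s1" "0 \<le> s2" unfolding s1_def s2_def using g by (auto intro: sum_nonneg)
    have up: "s1 + s2 \<le> N + 12 * \<delta> * real p"
      unfolding s1_def s2_def g1_def g2_def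
      by (rule saturated_sum_le[OF f1(1) f2(1) f1(2) f2(2) f1(3) f2(3) sum1 sum2 A(3) m0 m\<alpha> \<delta>(1,4) N_def False])
    define W where "W = 1 + (1 + 2 / \<alpha> ^ k) ^ m"
    have W: "wiener (\<lambda>x. 1 - (1 - smooth T (indic (periodic_ext S)) x) ^ m) W" for S
    proof -
      have "real p / real (card T) \<le> 2 / \<alpha> ^ k"
      proof -
        have "b > 0 \<Longrightarrow> real p * b / 2 \<le> real (card T) \<Longrightarrow> real p / real (card T) \<le> 2 / b" for b
          using cT0 by (simp add: field_simps)
        from this[OF _ cT] show ?thesis using A(3) by simp
      qed
      then have "wiener (smooth T (indic (periodic_ext S))) (2 / \<alpha> ^ k)"
        using wiener_mono wiener_smooth[OF T(1) fT(2) periodic_set_ext] by blast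
      from wiener_diff[OF wiener_const[of 1] wiener_power[OF wiener_diff[OF wiener_const[of 1] this]]]
      show ?thesis by (simp add: W_def)
    qed
    have "(\<Sum>x\<in>Gs. g1 x * g2 (inv_mod x)) \<le> s1 * s2 / real p + W * W * (2 * real p powr (3/4))"
      unfolding s1_def s2_def
    proof (rule reciprocal_equidistribution)
      show "wiener g1 W" using W[of A] unfolding g1_def[abs_def] f1_def .
      show "wiener g2 W" using W[of B] unfolding g2_def[abs_def] f2_def .
    qed (rule g)+
    also have "\<dots> \<le> s1 * s2 / real p + \<delta>\<^sup>2 * real p"
      using K by (simp add: W_def power2_eq_square)
    finally have eq: "(\<Sum>x\<in>Gs. g1 x * g2 (inv_mod x)) \<le> s1 * s2 / real p + \<delta>\<^sup>2 * real p" .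
    have miss: "(\<Sum>x\<in>S. (1 - smooth T (indic (periodic_ext S)) x) ^ m) \<le> 4 * real p / real m" if "S \<subseteq> G" for S
    proof -
      have "(\<Sum>x\<in>S. (1 - smooth T (indic (periodic_ext S)) x) ^ m)
          = (\<Sum>x\<in>G. indic (periodic_ext S) x * (1 - smooth T (indic (periodic_ext S)) x) ^ m)"
        using that by (intro sum.mono_neutral_cong_left) (auto simp: indic_ext)
      then show ?thesis using sum_unsaturated_le[OF fT periodic_set_ext m0] by simp
    qed
    \<comment> \<open>The unsaturated parts on A and on its inverse set cost 4 p/m each, together at
      most 8 sqrt \<alpha> \<delta> p. The Kloosterman error \<delta>^2 p <= sqrt \<alpha> \<delta>
      p raises the 8 to 9.\<close>
    have "\<alpha> * real p = (\<Sum>x\<in>A. 1)" using A(2) by simp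
    also have "\<dots> \<le> (\<Sum>x\<in>A. g1 x * g2 (inv_mod x) + (1 - f1 x) ^ m + (1 - f2 (inv_mod x)) ^ m)"
    proof (rule sum_mono)
      fix x
      have "0 \<le> (1 - g1 x) * (1 - g2 (inv_mod x))" using g by simp
      then show "1 \<le> g1 x * g2 (inv_mod x) + (1 - f1 x) ^ m + (1 - f2 (inv_mod x)) ^ m"
        by (simp add: g1_def g2_def algebra_simps)
    qed
    also have "\<dots> = (\<Sum>x\<in>A. g1 x * g2 (inv_mod x)) + (\<Sum>x\<in>A. (1 - f1 x) ^ m) + (\<Sum>x\<in>B. (1 - f2 x) ^ m)"
      unfolding B_def by (simp add: sum.distrib sum.reindex[OF inj])
    also have "\<dots> \<le> (\<Sum>x\<in>Gs. g1 x * g2 (inv_mod x)) + 4 * real p / real m + 4 * real p / real m"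
      using miss[OF AG] miss[OF BG] g A(1) unfolding f1_def f2_def
      by (intro add_mono sum_mono2) auto
    also have "\<dots> \<le> s1 * s2 / real p + \<delta>\<^sup>2 * real p + 8 * (sqrt \<alpha> * \<delta>) * real p"
      using eq mult_right_mono[OF im(1), of "8 * real p"] by simp
    also have "\<dots> \<le> s1 * s2 / real p + 9 * (sqrt \<alpha> * \<delta>) * real p"
    proof -
      have "\<delta>\<^sup>2 * real p \<le> sqrt \<alpha> * \<delta> * real p"
        unfolding power2_eq_square using \<delta> by (intro mult_right_mono) auto
      then show ?thesis by (simp add: algebra_simps)
    qed
    finally have "(\<alpha> - 9 * (sqrt \<alpha> * \<delta>)) * real p \<le> s1 * s2 / real p"
      by (simp add: left_diff_distrib)
    moreover have "c * real p \<le> s1 * s2 / real p \<Longrightarrow> c \<le> s1 / real p * (s2 / real p)" for c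
      by (simp add: field_simps)
    ultimately have "(sqrt \<alpha>)\<^sup>2 - 9 * sqrt \<alpha> * \<delta> \<le> s1 / real p * (s2 / real p)"
      using A(3) by (simp add: mult.assoc)
    then have "2 * sqrt \<alpha> - 18 * \<delta> \<le> s1 / real p + s2 / real p"
      using s0 \<delta>(1) by (intro add_ge_of_mult_ge) auto
    then have "(2 * sqrt \<alpha> - 18 * \<delta>) * real p \<le> s1 + s2" by (simp add: field_simps)
    then show ?thesis using up by (simp add: algebra_simps)
  qed
  then show ?thesis using NP unfolding P_def f_def B_def by linarith
qed

end

section \<open>Choice of parameters\<close>

text \<open>In terms of \<delta> the lower bound on \<epsilon> reads 625 u^(4/3) / l^(2/3) <=
  \<delta>^4, and its power 3/2 is 15625 u^2 <= \<delta>^6 l. In particular \<delta>^6 l >= 1, so -6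
  ln \<delta> <= u, and u^2 may be replaced by 36 (ln \<delta>)^2.\<close>

lemma delta_bound:
  fixes p \<alpha> \<epsilon> \<delta> :: real
  assumes \<delta>: "0 < \<delta>" "\<alpha> * \<delta> ^ 4 = 68 * \<epsilon>" and \<alpha>: "0 < \<alpha>" and ll: "1 \<le> ln (ln p)" "0 < ln p" and d1: "\<delta> \<le> 1"
    and \<epsilon>: "\<epsilon> \<ge> 625 / 68 * (\<alpha> * (ln (ln p) powr (4/3) / ln p powr (2/3)))"
  shows "562500 * (- ln \<delta>)\<^sup>2 \<le> \<delta> ^ 6 * ln p"
proof -
  define l u where "l = ln p" and "u = ln (ln p)"
  have l: "0 < l" "1 \<le> u" "ln l = u" using ll by (auto simp: l_def u_def)
  define q where "q = u powr (4/3) / l powr (2/3)"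
  have q: "0 < q" using l by (simp add: q_def)
  have q3: "q ^ 3 = u ^ 4 / l\<^sup>2"
  proof -
    have "(u powr (4/3)) ^ 3 = u powr 4" "(l powr (2/3)) ^ 3 = l powr 2"
      using powr_power[of u "4/3" 3] powr_power[of l "2/3" 3] l by simp_all
    then show ?thesis using l by (simp add: q_def power_divide)
  qed
  have "68 * (625 / 68 * (\<alpha> * q)) \<le> \<alpha> * \<delta> ^ 4" using \<epsilon> \<delta> unfolding q_def u_def l_def by linarith
  then have "\<alpha> * (625 * q) \<le> \<alpha> * \<delta> ^ 4" by (simp add: mult_ac)
  then have "625 * q \<le> \<delta> ^ 4" using \<alpha> by simp
  then have "(625 * q) ^ 3 \<le> (\<delta> ^ 4) ^ 3" using q by (intro power_mono) auto
  then have "(15625 * u\<^sup>2 / l)\<^sup>2 \<le> (\<delta> ^ 6)\<^sup>2"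
    by (simp add: power_mult_distrib q3 power_divide flip: power_mult)
  then have "15625 * u\<^sup>2 / l \<le> \<delta> ^ 6" by (rule power2_le_imp_le) (use \<delta> in simp)
  then have X: "15625 * u\<^sup>2 \<le> \<delta> ^ 6 * l" using l by (simp add: field_simps)
  have "1 * 1 \<le> u * u" using l by (intro mult_mono) auto
  then have "1 \<le> \<delta> ^ 6 * l" using X by (simp add: power2_eq_square)
  then have "0 \<le> ln (\<delta> ^ 6 * l)" by simp
  also have "\<dots> = 6 * ln \<delta> + u" using \<delta> l by (simp add: ln_mult ln_realpow)
  finally have L: "6 * (- ln \<delta>) \<le> u" by linarith
  have "36 * M\<^sup>2 \<le> u\<^sup>2" if "6 * M \<le> u" "0 \<le> M" for M
    using power_mono[OF that(1), of 2] that(2) by (simp add: power_mult_distrib)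
  from this[OF L] have "36 * (- ln \<delta>)\<^sup>2 \<le> u\<^sup>2" using \<delta> d1 by simp
  then have "15625 * (36 * (- ln \<delta>)\<^sup>2) \<le> 15625 * u\<^sup>2" by (intro mult_left_mono) auto
  also note X
  finally show ?thesis by (simp add: l_def)
qed

text \<open>This decides how small \<delta> may be. With M = - ln \<delta>, the squared norm has
  logarithm at most 10 m k M <= 87060 M^2 / \<delta>^6, by \<alpha> >= \<delta>^2 and m <=
  1/\<delta>^2. Together with 3 M for the factor 2/\<delta>^2 it has to fit into the quarter of ln p
  that p^(3/4) leaves.\<close>

lemma wiener_product_bound:
  fixes p \<alpha> \<delta> :: real
  assumes \<delta>: "0 < \<delta>" "2 * \<delta> \<le> sqrt \<alpha>" and \<alpha>: "0 < \<alpha>" "\<alpha> \<le> 1" and p: "0 < p"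
    and L: "562500 * (- ln \<delta>)\<^sup>2 \<le> \<delta> ^ 6 * ln p"
    and m: "1 \<le> m" "real m \<le> 2 / (sqrt \<alpha> * \<delta>)"
    and k: "1 \<le> k" "real k \<le> 8706 * (- ln \<delta>) / \<delta> ^ 4"
  shows "(1 + (1 + 2 / \<alpha> ^ k) ^ m)\<^sup>2 * (2 * p powr (3/4)) \<le> \<delta>\<^sup>2 * p" and "1 \<le> \<delta> * p"
proof -
  define M where "M = - ln \<delta>"
  define Y where "Y = M\<^sup>2 / \<delta> ^ 6"
  have "sqrt \<alpha> \<le> 1" using \<alpha> by simp
  then have d2: "\<delta> \<le> 1/2" using \<delta> by linarith
  have eM: "exp M = 1 / \<delta>" using \<delta> by (simp add: M_def exp_minus inverse_eq_divide)
  have "ln 2 \<le> M" using d2 \<delta> ln_mono[of \<delta> "1/2"] by (simp add: M_def ln_div)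
  then have M: "1/2 \<le> M" using ln_2_bounds by linarith
  have d6: "\<delta> ^ 6 \<le> (1/2) ^ 6" using d2 \<delta> by (intro power_mono) auto
  have Y: "M \<le> Y"
  proof -
    have "\<delta> ^ 6 \<le> M" using d6 M by (simp add: power_divide)
    then have "M * \<delta> ^ 6 \<le> M * M" using M by (intro mult_left_mono) auto
    then show ?thesis using \<delta> by (simp add: Y_def power2_eq_square field_simps)
  qed
  have YL: "562500 * Y \<le> ln p" using L \<delta> by (simp add: Y_def M_def field_simps)
  have "M \<le> ln p" using Y YL M by linarith
  then have "exp M \<le> p" using p by (metis exp_le_cancel_iff exp_ln)
  then show "1 \<le> \<delta> * p" using eM \<delta> by (simp add: field_simps)
  have ak: "0 < \<alpha> ^ k" "\<alpha> ^ k \<le> 1" using \<alpha> by (auto intro: power_le_one)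
  have "exp (- (2 * M)) \<le> \<alpha>"
  proof -
    have "\<delta>\<^sup>2 \<le> (sqrt \<alpha>)\<^sup>2" using \<delta> by (intro power_mono) auto
    moreover have "exp (- (2 * M)) = (exp (- M))\<^sup>2" by (simp add: power2_eq_square flip: exp_add)
    ultimately show ?thesis using \<alpha> eM by (simp add: exp_minus)
  qed
  then have "exp (- (2 * M)) ^ k \<le> \<alpha> ^ k" by (intro power_mono) auto
  then have a1: "exp (- (2 * real k * M)) \<le> \<alpha> ^ k" by (simp add: mult_ac flip: exp_of_nat_mult)
  \<comment> \<open>With b = \<alpha>^k the norm is at most 2 (3/b)^m <= (6/b)^m. Here 6 is absorbed
    by exp (3 k M) and 1/b by exp (2 k M).\<close>
  have "6 \<le> exp M ^ 3"
  proof -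
    have "(2::real) ^ 3 \<le> exp M ^ 3" using d2 \<delta> unfolding eM by (intro power_mono) (auto simp: field_simps)
    then show ?thesis by simp
  qed
  also have "exp M ^ 3 = exp (3 * M)" by (simp flip: exp_of_nat_mult)
  also have "\<dots> \<le> exp (3 * real k * M)" using k M by simp
  finally have "6 / \<alpha> ^ k \<le> exp (3 * real k * M) / exp (- (2 * real k * M))"
    using a1 ak by (intro frac_le) auto
  also have "\<dots> = exp (5 * real k * M)" by (simp flip: exp_diff)
  finally have six: "6 / \<alpha> ^ k \<le> exp (5 * real k * M)" .
  have "1 + 2 / b \<le> 3 / b" if "0 < b" "b \<le> 1" for b :: real using that by (simp add: field_simps)
  from this[OF ak] have "1 + 2 / \<alpha> ^ k \<le> 3 / \<alpha> ^ k" .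
  then have "(1 + 2 / \<alpha> ^ k) ^ m \<le> (3 / \<alpha> ^ k) ^ m" using ak by (intro power_mono) auto
  moreover have "1 \<le> (3 / \<alpha> ^ k) ^ m"
  proof (rule one_le_power)
    show "1 \<le> 3 / \<alpha> ^ k" using ak by (subst pos_le_divide_eq) auto
  qed
  ultimately have "1 + (1 + 2 / \<alpha> ^ k) ^ m \<le> 2 * (3 / \<alpha> ^ k) ^ m" by linarith
  also have "\<dots> \<le> 2 ^ m * (3 / \<alpha> ^ k) ^ m"
    using m(1) ak power_increasing[of 1 m "2::real"] by (intro mult_right_mono) auto
  also have "\<dots> = (6 / \<alpha> ^ k) ^ m" by (simp flip: power_mult_distrib)
  also have "\<dots> \<le> exp (5 * real k * M) ^ m" using six ak by (intro power_mono) auto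
  finally have "(1 + (1 + 2 / \<alpha> ^ k) ^ m)\<^sup>2 \<le> (exp (5 * real k * M) ^ m)\<^sup>2"
    using ak by (intro power_mono) auto
  also have "\<dots> = exp (10 * (real m * real k * M))"
    by (simp add: mult_ac flip: exp_of_nat_mult exp_add power_mult)
  finally have W: "(1 + (1 + 2 / \<alpha> ^ k) ^ m)\<^sup>2 \<le> exp (10 * (real m * real k * M))" .
  have "real m \<le> 1 / \<delta>\<^sup>2"
  proof -
    have "2 * \<delta> * \<delta> \<le> sqrt \<alpha> * \<delta>" using \<delta> by (intro mult_right_mono) auto
    then have "2 / (sqrt \<alpha> * \<delta>) \<le> 2 / (2 * \<delta> * \<delta>)" using \<delta> \<alpha> by (intro divide_left_mono) auto
    then show ?thesis using m(2) by (simp add: power2_eq_square)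
  qed
  then have "real m * real k * M \<le> 1 / \<delta>\<^sup>2 * (8706 * M / \<delta> ^ 4) * M"
    using k M \<delta> unfolding M_def[symmetric] by (intro mult_right_mono mult_mono) auto
  also have "\<dots> = 8706 * Y" by (simp add: Y_def power2_eq_square eval_nat_numeral)
  finally have mk: "10 * (real m * real k * M) \<le> 87060 * Y" by linarith
  have "2 / \<delta>\<^sup>2 \<le> exp M ^ 3"
    unfolding eM using d2 \<delta> by (simp add: field_simps power2_eq_square eval_nat_numeral)
  also have "\<dots> = exp (3 * M)" by (simp flip: exp_of_nat_mult)
  finally have two: "2 / \<delta>\<^sup>2 \<le> exp (3 * M)" .
  have "(1 + (1 + 2 / \<alpha> ^ k) ^ m)\<^sup>2 * (2 / \<delta>\<^sup>2) \<le> exp (10 * (real m * real k * M)) * exp (3 * M)"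
    using W two by (intro mult_mono) auto
  also have "\<dots> = exp (10 * (real m * real k * M) + 3 * M)" by (simp add: exp_add)
  also have "\<dots> \<le> exp (1/4 * ln p)"
  proof -
    have "10 * (real m * real k * M) + 3 * M \<le> 1/4 * ln p" using mk Y YL M by linarith
    then show ?thesis by (simp only: exp_le_cancel_iff)
  qed
  also have "\<dots> = p powr (1/4)" using p by (simp add: powr_def)
  finally have "(1 + (1 + 2 / \<alpha> ^ k) ^ m)\<^sup>2 * (2 / \<delta>\<^sup>2) * p powr (3/4) \<le> p powr (1/4) * p powr (3/4)"
    by (intro mult_right_mono) auto
  also have "\<dots> = p" using p by (simp flip: powr_add)
  finally have "(1 + (1 + 2 / \<alpha> ^ k) ^ m)\<^sup>2 * (2 / \<delta>\<^sup>2) * p powr (3/4) * \<delta>\<^sup>2 \<le> p * \<delta>\<^sup>2"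
    by (intro mult_right_mono) auto
  then show "(1 + (1 + 2 / \<alpha> ^ k) ^ m)\<^sup>2 * (2 * p powr (3/4)) \<le> \<delta>\<^sup>2 * p"
    using \<delta> by (simp add: mult_ac)
qed

text \<open>Since k \<epsilon> / (8 \<alpha>) = k \<delta>^4 / 544 and 16 \<alpha> / \<epsilon> =
  1088 / \<delta>^4, the condition is k >= r. From 1088 <= 2^11 and ln 2 <= M one gets ln (1088 /
  \<delta>^5) <= 16 M, whence 8704 = 544 * 16; rounding r up accounts for the remaining 2.\<close>

lemma sample_size:
  fixes \<delta> :: real
  assumes \<delta>: "0 < \<delta>" "\<delta> \<le> 1/2" "\<alpha> * \<delta> ^ 4 = 68 * \<epsilon>" "0 < \<alpha>"
  obtains k :: nat where "1 \<le> k" "real k \<le> 8706 * (- ln \<delta>) / \<delta> ^ 4"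
    "16 * exp (- real k * \<epsilon> / (8 * \<alpha>)) * \<alpha> / \<epsilon> \<le> \<delta>"
proof -
  define M where "M = - ln \<delta>"
  define r where "r = 544 / \<delta> ^ 4 * ln (1088 / \<delta> ^ 5)"
  have d5: "0 < \<delta> ^ 5" "\<delta> ^ 5 \<le> 1" "0 < \<delta> ^ 4" "\<delta> ^ 4 \<le> 1" using \<delta> by (auto intro: power_le_one)
  have "ln 2 \<le> M" using \<delta> ln_mono[of \<delta> "1/2"] by (simp add: M_def ln_div)
  then have M: "ln 2 \<le> M" "1/2 \<le> M" using ln_2_bounds by linarith+
  have "ln (1088 / \<delta> ^ 5) = ln 1088 + 5 * M"
    using \<delta> d5 by (simp add: ln_div ln_realpow M_def)
  moreover have "ln (1088::real) \<le> ln (2 ^ 11)" by (subst ln_le_cancel_iff) auto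
  moreover have "ln ((2::real) ^ 11) = 11 * ln 2" by (subst ln_realpow) auto
  ultimately have lnle: "ln (1088 / \<delta> ^ 5) \<le> 16 * M" using M by linarith
  have lnpos: "0 < ln (1088 / \<delta> ^ 5)" using d5 by (simp add: field_simps)
  have r0: "0 < r" unfolding r_def using lnpos d5 by simp
  have "r \<le> 544 / \<delta> ^ 4 * (16 * M)" unfolding r_def using lnle d5 by (intro mult_left_mono) auto
  then have r1: "r \<le> 8704 * M / \<delta> ^ 4" by simp
  moreover have "1 \<le> 2 * M / \<delta> ^ 4" using M d5 by (simp add: field_simps)
  then have r2: "r + 1 \<le> 8706 * M / \<delta> ^ 4" using r1 by linarith
  define k where "k = nat \<lceil>r\<rceil>"
  have k: "r \<le> real k" "real k \<le> r + 1" unfolding k_def using r0 by linarith+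
  have "0 < real k" using k r0 by linarith
  then have k1: "1 \<le> k" by simp
  have eps: "\<epsilon> = \<alpha> * \<delta> ^ 4 / 68" using \<delta>(3) by simp
  have "ln (1088 / \<delta> ^ 5) = r * \<delta> ^ 4 / 544" unfolding r_def using d5 by simp
  also have "\<dots> \<le> real k * \<delta> ^ 4 / 544" using k d5 by (intro divide_right_mono mult_right_mono) auto
  also have "\<dots> = real k * \<epsilon> / (8 * \<alpha>)" unfolding eps using \<delta>(4) by simp
  finally have "exp (- real k * \<epsilon> / (8 * \<alpha>)) \<le> exp (- ln (1088 / \<delta> ^ 5))" by simp
  also have "\<dots> = \<delta> ^ 5 / 1088" using d5 by (simp add: exp_minus)
  finally have "16 * exp (- real k * \<epsilon> / (8 * \<alpha>)) * (68 / \<delta> ^ 4) \<le> 16 * (\<delta> ^ 5 / 1088) * (68 / \<delta> ^ 4)"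
    using d5 by (intro mult_right_mono mult_left_mono) auto
  also have "\<dots> = \<delta>" using \<delta>(1) by (simp add: eval_nat_numeral)
  also have "16 * exp (- real k * \<epsilon> / (8 * \<alpha>)) * (68 / \<delta> ^ 4) = 16 * exp (- real k * \<epsilon> / (8 * \<alpha>)) * (\<alpha> / \<epsilon>)"
    unfolding eps using \<delta>(4) by simp
  finally have "16 * exp (- real k * \<epsilon> / (8 * \<alpha>)) * \<alpha> / \<epsilon> \<le> \<delta>" by simp
  then show thesis using that k1 k r2 unfolding M_def by fastforce
qed

context prime_modulus begin

text \<open>The return from periodic functions to the ring: each value of the convolution counts
  pairs with the given ring sum. Positivity of \<epsilon> provides at least one pair, so a popular z
  lies in the sumset.\<close>

lemma card_mod_le_card_partial_sumset:
  assumes A: "A \<subseteq> Gs" and \<epsilon>: "0 < \<epsilon>"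
  shows "card_mod {z. \<epsilon> * real p \<le> conv (indic (periodic_ext A)) (indic (periodic_ext (inv_mod ` A))) z}
    \<le> real (card (partial_sumset p \<epsilon> A (inverse_set p A)))"
proof -
  interpret res: residues_prime p "Fp p"
    by unfold_locales (use prime_p in auto)
  define B where "B = inv_mod ` A"
  have B: "inverse_set p A = B" by (auto simp: inverse_set_def B_def inv_mod_def)
  have AG: "A \<subseteq> G" and BG: "B \<subseteq> G" using A inv_mod(1) unfolding B_def by fastforce+
  have fA: "finite A" "finite B" using AG BG finite_subset by blast+
  have cc: "conv (indic (periodic_ext A)) (indic (periodic_ext B)) z \<le> real (conv_count p A B z)" if z: "z \<in> G" for z
  proof -
    have "conv (indic (periodic_ext A)) (indic (periodic_ext B)) z = real (card {x \<in> G. x \<in> periodic_ext A \<and> z - x \<in> periodic_ext B})"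
    proof -
      have "conv (indic (periodic_ext A)) (indic (periodic_ext B)) z = (\<Sum>x\<in>G. if x \<in> periodic_ext A \<and> z - x \<in> periodic_ext B then 1 else 0)"
        unfolding conv_def by (intro sum.cong refl) (simp add: indic_def)
      then show ?thesis by (simp flip: sum.inter_filter)
    qed
    also have "{x \<in> G. x \<in> periodic_ext A \<and> z - x \<in> periodic_ext B} = {x \<in> A. (z - x) mod int p \<in> B}"
      using AG by (auto simp: periodic_ext_def)
    also have "card {x \<in> A. (z - x) mod int p \<in> B}
        = card ((\<lambda>x. (x, (z - x) mod int p)) ` {x \<in> A. (z - x) mod int p \<in> B})"
      by (rule card_image[symmetric]) (auto simp: inj_on_def)
    also have "\<dots> \<le> conv_count p A B z"
      unfolding conv_count_def
    proof (rule card_mono)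
      show "finite {(x, y). x \<in> A \<and> y \<in> B \<and> x \<oplus>\<^bsub>Fp p\<^esub> y = z}"
        by (rule finite_subset[of _ "A \<times> B"]) (use fA in auto)
      show "(\<lambda>x. (x, (z - x) mod int p)) ` {x \<in> A. (z - x) mod int p \<in> B}
          \<subseteq> {(x, y). x \<in> A \<and> y \<in> B \<and> x \<oplus>\<^bsub>Fp p\<^esub> y = z}"
        using z by (auto simp: res.res_add_eq mod_simps)
    qed
    finally show ?thesis by simp
  qed
  have sub: "{z. \<epsilon> * real p \<le> conv (indic (periodic_ext A)) (indic (periodic_ext B)) z} \<inter> G \<subseteq> partial_sumset p \<epsilon> A B"
  proof safe
    fix z assume z: "\<epsilon> * real p \<le> conv (indic (periodic_ext A)) (indic (periodic_ext B)) z" "z \<in> G"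
    have c: "\<epsilon> * real p \<le> real (conv_count p A B z)" using cc[OF z(2)] z(1) by linarith
    moreover have "0 < \<epsilon> * real p" using \<epsilon> by simp
    ultimately have "conv_count p A B z \<noteq> 0" by linarith
    then have "{(x, y). x \<in> A \<and> y \<in> B \<and> x \<oplus>\<^bsub>Fp p\<^esub> y = z} \<noteq> {}"
      unfolding conv_count_def by (metis card.empty)
    then obtain x y where "x \<in> A" "y \<in> B" "x \<oplus>\<^bsub>Fp p\<^esub> y = z" by blast
    then have "z \<in> A <+>\<^bsub>Fp p\<^esub> B" unfolding set_add_def' by blast
    then show "z \<in> partial_sumset p \<epsilon> A B" using c by (simp add: partial_sumset_def)
  qed
  have "finite (partial_sumset p \<epsilon> A B)"
  proof (rule finite_subset[of _ "(\<lambda>(x, y). x \<oplus>\<^bsub>Fp p\<^esub> y) ` (A \<times> B)"])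
    show "partial_sumset p \<epsilon> A B \<subseteq> (\<lambda>(x, y). x \<oplus>\<^bsub>Fp p\<^esub> y) ` (A \<times> B)"
      by (auto simp: partial_sumset_def set_add_def')
  qed (use fA in auto)
  then show ?thesis unfolding B B_def[symmetric] card_mod_eq_card using card_mono[OF _ sub] by simp
qed

text \<open>Here \<delta> is the fourth root of 68 \<epsilon> / \<alpha>. As 1088 = 16 * 68, the
  upper bound on \<epsilon> says (2 \<delta>)^4 <= \<alpha>^2. The 100 covers 31 times the fourth
  root of 68, which is below 3.\<close>

lemma card_partial_sumset_ge:
  assumes A: "A \<subseteq> Gs" "real (card A) = \<alpha> * real p" and ll: "1 \<le> ln (ln (real p))" "0 < ln (real p)"
    and \<epsilon>: "0 < \<epsilon>" "1088 * \<epsilon> \<le> \<alpha> ^ 3"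
      "\<epsilon> \<ge> 625 / 68 * (\<alpha> * (ln (ln (real p)) powr (4/3) / ln (real p) powr (2/3)))"
  shows "real (card (partial_sumset p \<epsilon> A (inverse_set p A)))
    \<ge> min (2 * sqrt (real (card A) * real p)) (real p) - 100 * (\<epsilon> powr (1/4) / \<alpha> powr (1/4)) * real p"
proof -
  have "0 \<le> \<alpha> * real p" using A(2) by (metis of_nat_0_le_iff)
  then have "0 \<le> \<alpha>" using p_pos by (simp add: zero_le_mult_iff)
  moreover have "\<alpha> \<noteq> 0" using \<epsilon> by auto
  ultimately have \<alpha>: "0 < \<alpha>" by simp
  have "A \<subseteq> G" using A(1) by auto
  then have "card A \<le> p" using card_mono[of G A] by simp
  then have "real (card A) \<le> real p" by (rule of_nat_mono)
  then have "\<alpha> * real p \<le> 1 * real p" unfolding A(2) by linarith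
  then have \<alpha>1: "\<alpha> \<le> 1" by (subst (asm) mult_le_cancel_right_pos) auto
  define \<delta> where "\<delta> = (68 * \<epsilon> / \<alpha>) powr (1/4)"
  have \<delta>0: "0 < \<delta>" using \<alpha> \<epsilon> by (simp add: \<delta>_def)
  have "\<delta> ^ 4 = 68 * \<epsilon> / \<alpha>" unfolding \<delta>_def using \<alpha> \<epsilon> by (simp add: powr_power)
  then have \<delta>4: "\<alpha> * \<delta> ^ 4 = 68 * \<epsilon>" using \<alpha> by simp
  have "\<alpha> * (16 * \<delta> ^ 4) \<le> \<alpha> * \<alpha>\<^sup>2" using \<epsilon>(2) \<delta>4 by (simp add: power2_eq_square eval_nat_numeral)
  then have "16 * \<delta> ^ 4 \<le> \<alpha>\<^sup>2" using \<alpha> by simp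
  moreover have "(4 * \<delta>\<^sup>2)\<^sup>2 = 16 * \<delta> ^ 4" by (simp add: power_mult_distrib flip: power_mult)
  ultimately have "(4 * \<delta>\<^sup>2)\<^sup>2 \<le> \<alpha>\<^sup>2" by simp
  then have "4 * \<delta>\<^sup>2 \<le> \<alpha>" by (rule power2_le_imp_le) (use \<alpha> in simp)
  then have "(2 * \<delta>)\<^sup>2 \<le> \<alpha>" by (simp add: power_mult_distrib)
  then have \<delta>2: "2 * \<delta> \<le> sqrt \<alpha>" by (rule real_le_rsqrt)
  have s1: "0 < sqrt \<alpha>" "sqrt \<alpha> \<le> 1" using \<alpha> \<alpha>1 by auto
  have \<delta>h: "\<delta> \<le> 1/2" using \<delta>2 s1 by linarith
  have L: "562500 * (- ln \<delta>)\<^sup>2 \<le> \<delta> ^ 6 * ln (real p)"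
    using \<delta>h by (intro delta_bound[OF \<delta>0 \<delta>4 \<alpha> ll _ \<epsilon>(3)]) simp
  obtain k :: nat where k: "1 \<le> k" "real k \<le> 8706 * (- ln \<delta>) / \<delta> ^ 4"
    "16 * exp (- real k * \<epsilon> / (8 * \<alpha>)) * \<alpha> / \<epsilon> \<le> \<delta>"
    using sample_size[OF \<delta>0 \<delta>h \<delta>4 \<alpha>] by blast
  define m where "m = nat \<lceil>1 / (sqrt \<alpha> * \<delta>)\<rceil>"
  have "sqrt \<alpha> * \<delta> \<le> 1 * 1" using s1 \<delta>h \<delta>0 by (intro mult_mono) auto
  then have inv1: "1 \<le> 1 / (sqrt \<alpha> * \<delta>)" using s1 \<delta>0 by simp
  have m: "1 / (sqrt \<alpha> * \<delta>) \<le> real m" "real m \<le> 1 / (sqrt \<alpha> * \<delta>) + 1"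
    unfolding m_def using inv1 by linarith+
  have "1 \<le> real m" using m inv1 by linarith
  then have m1: "1 \<le> m" by simp
  have m2: "real m \<le> 2 / (sqrt \<alpha> * \<delta>)"
  proof -
    have "x \<le> 2 / d" if "0 < d" "1 \<le> 1 / d" "x \<le> 1 / d + 1" for x d :: real
      using that by (simp add: field_simps)
    from this[OF _ inv1 m(2)] show ?thesis using s1 \<delta>0 by simp
  qed
  note wp = wiener_product_bound[OF \<delta>0 \<delta>2 \<alpha> \<alpha>1 _ L m1 m2 k(1,2)]
  have \<delta>s: "\<delta> \<le> sqrt \<alpha>" using \<delta>2 \<delta>0 by linarith
  have "min (2 * sqrt \<alpha> * real p) (real p) - 31 * \<delta> * real p
      \<le> card_mod {z. \<epsilon> * real p \<le> conv (indic (periodic_ext A)) (indic (periodic_ext (inv_mod ` A))) z}"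
    by (rule card_mod_popular_reciprocal[OF A \<alpha> \<delta>0 \<delta>4 \<delta>s wp(2) m(1) m2 _ k(3) wp(1)])
      (use k(1) in auto)
  also have "\<dots> \<le> real (card (partial_sumset p \<epsilon> A (inverse_set p A)))"
    by (rule card_mod_le_card_partial_sumset[OF A(1) \<epsilon>(1)])
  finally have main: "min (2 * sqrt \<alpha> * real p) (real p) - 31 * \<delta> * real p
      \<le> real (card (partial_sumset p \<epsilon> A (inverse_set p A)))" .
  have "sqrt (real (card A) * real p) = sqrt \<alpha> * real p"
    by (simp add: A(2) real_sqrt_mult mult.assoc)
  moreover have "31 * \<delta> * real p \<le> 100 * (\<epsilon> powr (1/4) / \<alpha> powr (1/4)) * real p"
  proof (rule mult_right_mono)
    have "(68::real) powr (1/4) \<le> 81 powr (1/4)" by (intro powr_mono2) auto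
    also have "(81::real) powr (1/4) = (3 powr 4) powr (1/4)" by simp
    also have "\<dots> = 3" unfolding powr_powr by simp
    finally have "68 powr (1/4) * (\<epsilon> powr (1/4) / \<alpha> powr (1/4)) \<le> 3 * (\<epsilon> powr (1/4) / \<alpha> powr (1/4))"
      by (intro mult_right_mono) auto
    moreover have "\<delta> = 68 powr (1/4) * (\<epsilon> powr (1/4) / \<alpha> powr (1/4))"
      unfolding \<delta>_def using \<alpha> \<epsilon>(1) by (simp add: powr_divide powr_mult)
    moreover have "0 \<le> \<epsilon> powr (1/4) / \<alpha> powr (1/4)" by simp
    ultimately show "31 * \<delta> \<le> 100 * (\<epsilon> powr (1/4) / \<alpha> powr (1/4))" by linarith
  qed simp
  ultimately show ?thesis using main by (simp add: mult.assoc)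
qed

end

text \<open>The sumset contains all its partial sumsets, so the first claim is the second one at the
  smallest admissible \<epsilon>.\<close>

theorem theorem2:
  shows "\<exists>c\<^sub>1 c\<^sub>2 c\<^sub>3 C\<^sub>1 C\<^sub>2 :: real.
    c\<^sub>1 > 0 \<and> c\<^sub>2 > 0 \<and> c\<^sub>3 > 0 \<and> C\<^sub>1 > 0 \<and> C\<^sub>2 > 0 \<and>
    (\<exists>p\<^sub>0 :: nat. \<forall>p \<ge> p\<^sub>0. prime p \<longrightarrow>
      (\<forall>(A :: int set) (\<alpha> :: real).
        A \<subseteq> carrier (Fp p) - {\<zero>\<^bsub>Fp p\<^esub>} \<and>
        real (card A) = \<alpha> * real p \<and>
        \<alpha> \<ge> c\<^sub>1 * (ln (ln (real p)) powr (2/3) / ln (real p) powr (1/3)) \<longrightarrow>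
        real (card (A <+>\<^bsub>Fp p\<^esub> inverse_set p A))
          > min (2 * sqrt (real (card A) * real p)) (real p)
            - C\<^sub>1 * (ln (ln (real p)) powr (1/3) / ln (real p) powr (1/6)) * real p
        \<and>
        (\<forall>\<epsilon> :: real. \<epsilon> > 0 \<and>
          \<alpha> ^ 3 \<ge> c\<^sub>2 * \<epsilon> \<and>
          \<epsilon> \<ge> c\<^sub>3 * (\<alpha> * (ln (ln (real p)) powr (4/3) / ln (real p) powr (2/3))) \<longrightarrow>
          real (card (partial_sumset p \<epsilon> A (inverse_set p A)))
            \<ge> min (2 * sqrt (real (card A) * real p)) (real p)
              - C\<^sub>2 * (\<epsilon> powr (1/4) / \<alpha> powr (1/4)) * real p)))"
proof -
  have part1: "real (card (A <+>\<^bsub>Fp p\<^esub> inverse_set p A))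
      > min (2 * sqrt (real (card A) * real p)) (real p)
        - 201 * (ln (ln (real p)) powr (1/3) / ln (real p) powr (1/6)) * real p" (is ?sum)
    and part2: "\<And>\<epsilon>. \<epsilon> > 0 \<and> \<alpha> ^ 3 \<ge> 1088 * \<epsilon> \<and>
        \<epsilon> \<ge> 625 / 68 * (\<alpha> * (ln (ln (real p)) powr (4/3) / ln (real p) powr (2/3))) \<Longrightarrow>
        real (card (partial_sumset p \<epsilon> A (inverse_set p A)))
          \<ge> min (2 * sqrt (real (card A) * real p)) (real p)
            - 100 * (\<epsilon> powr (1/4) / \<alpha> powr (1/4)) * real p"
    if p: "nat \<lceil>exp (exp 1 :: real)\<rceil> \<le> p" "prime p"
      and A: "A \<subseteq> carrier (Fp p) - {\<zero>\<^bsub>Fp p\<^esub>}" "real (card A) = \<alpha> * real p"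
      and \<alpha>: "\<alpha> \<ge> 100 * (ln (ln (real p)) powr (2/3) / ln (real p) powr (1/3))"
    for p :: nat and A \<alpha>
  proof -
    interpret prime_modulus p by unfold_locales (rule p(2))
    interpret res: residues_prime p "Fp p"
      by unfold_locales (use p(2) in auto)
    have AGs: "A \<subseteq> Gs" using A(1) by (auto simp: res.res_carrier_eq res.res_zero_eq)
    define l u where "l = ln (real p)" and "u = ln (ln (real p))"
    \<comment> \<open>The threshold on p serves to make ln (ln p) at least 1.\<close>
    have "exp (exp 1) \<le> real p" using p(1) by linarith
    then have "exp 1 \<le> l" unfolding l_def by (subst ln_ge_iff) auto
    moreover have "0 < exp (1::real)" by simp
    ultimately have l: "0 < l" "exp 1 \<le> l" by linarith+
    then have u: "1 \<le> u" unfolding u_def l_def[symmetric] by (subst ln_ge_iff) auto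
    note ge = card_partial_sumset_ge[OF AGs A(2) u[unfolded u_def] l(1)[unfolded l_def]]
    then show "real (card (partial_sumset p \<epsilon> A (inverse_set p A)))
          \<ge> min (2 * sqrt (real (card A) * real p)) (real p)
            - 100 * (\<epsilon> powr (1/4) / \<alpha> powr (1/4)) * real p"
      if "\<epsilon> > 0 \<and> \<alpha> ^ 3 \<ge> 1088 * \<epsilon> \<and>
        \<epsilon> \<ge> 625 / 68 * (\<alpha> * (ln (ln (real p)) powr (4/3) / ln (real p) powr (2/3)))" for \<epsilon>
      using that by blast
    define q where "q = u powr (4/3) / l powr (2/3)"
    define w where "w = u powr (1/3) / l powr (1/6)"
    have q: "0 < q" and w: "0 < w" using l u by (simp_all add: q_def w_def)
    have qw: "q = w ^ 4" 
    using powr_power[of u "1/3" 4] powr_power[of l "1/6" 4] l u unfolding q_def w_def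
    by (simp add: power_divide)
    have "100 * (u powr (2/3) / l powr (1/3)) \<le> \<alpha>" using \<alpha> unfolding u_def l_def .
    then have \<alpha>w: "100 * w\<^sup>2 \<le> \<alpha>"
      using powr_power[of u "1/3" 2] powr_power[of l "1/6" 2] l u
      unfolding w_def by (simp add: power_divide)
    then have \<alpha>0: "0 < \<alpha>" using w by (smt (verit) zero_less_power)
    \<comment> \<open>At this lower end, 1088 \<epsilon> <= \<alpha>^3 means 10000 q <= \<alpha>^2.
      This is the square of 100 w^2 <= \<alpha> and the origin of the constant 100 in the hypothesis
      on \<alpha>.\<close>
    define \<epsilon> where "\<epsilon> = 625 / 68 * (\<alpha> * q)"
    have \<epsilon>: "0 < \<epsilon>" using \<alpha>0 q by (simp add: \<epsilon>_def)
    have "(100 * w\<^sup>2)\<^sup>2 \<le> \<alpha>\<^sup>2" using \<alpha>w by (intro power_mono) auto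
    then have "10000 * q \<le> \<alpha>\<^sup>2" by (simp add: qw power_mult_distrib flip: power_mult)
    then have "\<alpha> * (10000 * q) \<le> \<alpha> * \<alpha>\<^sup>2" using \<alpha>0 by (intro mult_left_mono) auto
    then have \<epsilon>3: "1088 * \<epsilon> \<le> \<alpha> ^ 3" by (simp add: \<epsilon>_def power2_eq_square eval_nat_numeral)
    have "\<epsilon> powr (1/4) / \<alpha> powr (1/4) = (\<epsilon> / \<alpha>) powr (1/4)"
      using \<epsilon> \<alpha>0 by (simp add: powr_divide)
    also have "\<epsilon> / \<alpha> = 625 / 68 * w ^ 4" using \<alpha>0 by (simp add: \<epsilon>_def qw)
    \<comment> \<open>As 625/68 < 16, the error is at most 200 w p; the constant 201 then makes the
      inequality strict.\<close>
    also have "(625 / 68 * w ^ 4) powr (1/4) \<le> ((2 * w) powr 4) powr (1/4)"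
      using w by (intro powr_mono2) (auto simp: power_mult_distrib)
    also have "\<dots> = 2 * w" using w by (simp add: powr_powr del: powr_numeral)
    finally have root: "\<epsilon> powr (1/4) / \<alpha> powr (1/4) \<le> 2 * w" .
    have "min (2 * sqrt (real (card A) * real p)) (real p) - 201 * w * real p
        < min (2 * sqrt (real (card A) * real p)) (real p) - 200 * w * real p"
      using w p_pos by simp
    also have "\<dots> \<le> min (2 * sqrt (real (card A) * real p)) (real p)
        - 100 * (\<epsilon> powr (1/4) / \<alpha> powr (1/4)) * real p"
      using mult_right_mono[OF root, of "100 * real p"] by (simp add: mult_ac)
    also have "\<dots> \<le> real (card (partial_sumset p \<epsilon> A (inverse_set p A)))"
      using \<epsilon> \<epsilon>3 by (intro ge) (simp_all add: \<epsilon>_def q_def u_def l_def)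
    also have "\<dots> \<le> real (card (A <+>\<^bsub>Fp p\<^esub> inverse_set p A))"
    proof (intro of_nat_mono card_mono)
      have "finite A" using AGs finite_subset by blast
      then have fin: "finite ((\<lambda>(x, y). x \<oplus>\<^bsub>Fp p\<^esub> y) ` (A \<times> inverse_set p A))"
        by (simp add: inverse_set_def)
      show "finite (A <+>\<^bsub>Fp p\<^esub> inverse_set p A)"
        by (rule finite_subset[OF _ fin]) (auto simp: set_add_def')
    qed (auto simp: partial_sumset_def)
    finally show ?sum unfolding w_def u_def l_def .
  qed
  show ?thesis
    by (rule exI[of _ 100], rule exI[of _ 1088], rule exI[of _ "625/68"], rule exI[of _ 201],
        rule exI[of _ 100], intro conjI exI[of _ "nat \<lceil>exp (exp 1 :: real)\<rceil>"] allI impI)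
      (use part1 part2 in auto)
qed

end
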